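(* Let $n\ge2$, let $\mathcal{P}$ be a probability distribution on $\mathcal{Z}=\mathcal{X}\times\mathcal{Y}$, let $\mathcal{A}:\mathcal{Z}^{n-1}\to\mathcal{W}\subseteq\mathbb{R}^K$ be a possibly stochastic training algorithm, and let $\ell:\mathcal{W}\times\mathcal{Z}\to[0,1]$ be a (measurable) loss. Then \[ \mathrm{gen}(\mathcal{A})\le \frac{c_n}{\sqrt2}\,\mathbb{E}_{z^n\sim\mathcal{P}^n}\sqrt{\mathrm{loo\text{-}CMI}(\mathcal{A},z^n)},\qquad c_n=\frac{n}{n-1}. \]
   Context: The algorithm's internal randomness is independent of the data and of the index $U$ below. True loss: $\mathcal{L}(w)=\mathbb{E}_{Z'\sim\mathcal{P}}[\ell(w,Z')]$; empirical loss on $z^m$: $\widehat{\mathcal{L}}(w,z^m)=\frac1m\sum_{i=1}^m\ell(w,z_i)$. Generalization gap: $\mathrm{gen}(\mathcal{A})=\big|\mathbb{E}\big[\mathcal{L}(\mathcal{A}(Z^{n-1}))-\widehat{\mathcal{L}}(\mathcal{A}(Z^{n-1}),Z^{n-1})\big]\big|$, where $Z^{n-1}\sim\mathcal{P}^{n-1}$ and the expectation is also over the randomness of $\mathcal{A}$. For $z^n\in\mathcal{Z}^n$ and $u\in[n]$, $z^{n-1}_{-u}$ denotes the $(n-1)$-tuple obtained from $z^n$ by deleting $z_u$. Let $U$ be uniform on $[n]$ and, for fixed $z^n$, $W=\mathcal{A}(z^{n-1}_{-U})$. The pointwise leave-one-out conditional mutual information is $\mathrm{loo\text{-}CMI}(\mathcal{A},z^n)=I(W;U\mid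 Z^n=z^n)$, i.e. the mutual information between $W$ and $U$ when the full dataset is fixed to $z^n$. *)

theory Defs
  imports "HOL-Analysis.Analysis" "HOL-Probability.Probability"
begin

text \<open>Datasets of size m are elements of the product space PiM {..<m} (\<lambda>_. P),
  i.e. extensional functions on the index set {0..<m}.  The index set [n] is {0..<n}.\<close>

definition loo_delete :: "nat \<Rightarrow> nat \<Rightarrow> (nat \<Rightarrow> 'z) \<Rightarrow> (nat \<Rightarrow> 'z)" where
  "loo_delete n u z = (\<lambda>i\<in>{..<n-1}. if i < u then z i else z (Suc i))"

definition true_loss :: "'z measure \<Rightarrow> ('w \<Rightarrow> 'z \<Rightarrow> real) \<Rightarrow> 'w \<Rightarrow> real" where
  "true_loss P l w = (\<integral>z. l w z \<partial>P)"

definition emp_loss :: "nat \<Rightarrow> ('w \<Rightarrow> 'z \<Rightarrow> real) \<Rightarrow> 'w \<Rightarrow> (nat \<Rightarrow> 'z) \<Rightarrow> real" where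
  "emp_loss m l w s = (1 / real m) * (\<Sum>i<m. l w (s i))"

text \<open>Generalization gap of the (stochastic) algorithm A, a Markov kernel from
  Z^(n-1) to W, trained on n-1 i.i.d. samples.  The expectation over the joint
  law of (Z^(n-1), A(Z^(n-1))) is written as the iterated integral.\<close>
definition gen_gap ::
  "nat \<Rightarrow> 'z measure \<Rightarrow> ((nat \<Rightarrow> 'z) \<Rightarrow> 'w measure) \<Rightarrow> ('w \<Rightarrow> 'z \<Rightarrow> real) \<Rightarrow> real" where
  "gen_gap n P A l =
     \<bar>\<integral>s. (\<integral>w. true_loss P l w - emp_loss (n-1) l w s \<partial>(A s)) \<partial>(PiM {..<n-1} (\<lambda>_. P))\<bar>"

definition loo_joint ::
  "nat \<Rightarrow> 'w measure \<Rightarrow> ((nat \<Rightarrow> 'z) \<Rightarrow> 'w measure) \<Rightarrow> (nat \<Rightarrow> 'z) \<Rightarrow> (nat \<times> 'w) measure" where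
  "loo_joint n Wm A z =
     uniform_count_measure {..<n} \<bind>
       (\<lambda>u. A (loo_delete n u z) \<bind> (\<lambda>w. return (count_space {..<n} \<Otimes>\<^sub>M Wm) (u, w)))"

definition loo_CMI ::
  "nat \<Rightarrow> 'w measure \<Rightarrow> ((nat \<Rightarrow> 'z) \<Rightarrow> 'w measure) \<Rightarrow> (nat \<Rightarrow> 'z) \<Rightarrow> real" where
  "loo_CMI n Wm A z =
     prob_space.mutual_information (loo_joint n Wm A z) (exp 1) Wm (count_space {..<n}) snd fst"

end

theory Submission
  imports Defs
begin

text \<open>
  For a fixed full sample \<open>z\<close>, the loss \<open>g (W, U) = l W (z U)\<close> takes values in \<open>[0, 1]\<close>, and the average over
  \<open>U\<close> of the leave-one-out gap equals \<open>n / (n - 1)\<close> times the difference of the means of \<open>g\<close> under the joint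
  law of \<open>(W, U)\<close> and under the product of its marginals. The inequality
  \<open>E\<^sub>J f - E\<^sub>Q (exp (f - 1)) \<le> KL\<close>, applied to an affine function of \<open>g\<close>, and Hoeffding's lemma bound this
  difference by \<open>sqrt (KL / 2)\<close>, where \<open>KL\<close> is the mutual information. By exchangeability the integral over
  \<open>z\<close> of the leave-one-out gap is the generalization gap.

  The right-hand side is a Bochner integral, which is \<open>0\<close> for non-measurable integrands, so the mutual
  information has to be shown measurable in \<open>z\<close>. The joint law is dominated by \<open>n\<close> times the
  product law, hence its density is bounded, and the variational formula expresses \<open>KL\<close> as a supremum over
  countably many clamped rational step functions on a countable generator of the \<open>\<sigma>\<close>-algebra.
\<close>

section \<open>Rational step functions are dense in L1\<close>

text \<open>Lists encode step functions because \<open>lists (UNIV \<times> G)\<close> is countable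
  for countable \<open>G\<close>. The sets may overlap, so that a sum is a concatenation.\<close>

definition rat_step :: "(rat \<times> 'a set) list \<Rightarrow> 'a \<Rightarrow> real" where
  "rat_step xs x = (\<Sum>(q, B)\<leftarrow>xs. of_rat q * indicator B x)"

lemma rat_step_simps:
  "rat_step [] x = 0"
  "rat_step ((q, B) # xs) x = of_rat q * indicator B x + rat_step xs x"
  "rat_step (xs @ ys) x = rat_step xs x + rat_step ys x"
  by (simp_all add: rat_step_def)

lemma rat_step_map_mult:
  "rat_step (map (\<lambda>(r, B). (q * r, B)) xs) x = of_rat q * rat_step xs x"
  by (induction xs) (auto simp: rat_step_simps of_rat_mult algebra_simps)

lemma borel_measurable_rat_step:
  assumes "xs \<in> lists (UNIV \<times> sets M)"
  shows "rat_step xs \<in> borel_measurable M"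
  using assms
proof (induction xs)
  case Nil
  then show ?case by (simp add: rat_step_simps[abs_def])
next
  case (Cons a xs)
  then show ?case
    by (cases a) (auto simp: rat_step_simps[abs_def])
qed

lemma (in finite_measure) integrable_rat_step:
  assumes "xs \<in> lists (UNIV \<times> sets M)"
  shows "integrable M (rat_step xs)"
  using assms
proof (induction xs)
  case Nil
  then show ?case by (simp add: rat_step_simps[abs_def])
next
  case (Cons a xs)
  then show ?case
    by (cases a) (auto simp: rat_step_simps[abs_def] less_top[symmetric])
qed

text \<open>The functions approximable in L1 form a closed subspace. Dynkin's pi-lambda argument,
  for which \<open>G\<close> is intersection-stable, puts all indicators of measurable sets into it;
  simple functions then reach every integrable function.\<close>

lemma (in finite_measure) rat_step_dense_L1:
  fixes f :: "'a \<Rightarrow> real"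
  assumes G: "Int_stable G" "G \<subseteq> Pow (space M)" "sets M = sigma_sets (space M) G" "space M \<in> G"
    and f: "integrable M f" and e: "0 < e"
  shows "\<exists>xs\<in>lists (UNIV \<times> G). (\<integral>x. \<bar>f x - rat_step xs x\<bar> \<partial>M) < e"
proof -
  define appr where
    "appr g \<longleftrightarrow> (\<forall>e>0. \<exists>xs\<in>lists (UNIV \<times> G). (\<integral>x. \<bar>g x - rat_step xs x\<bar> \<partial>M) < e)" for g
  have "G \<subseteq> sets M" using G(3) by auto
  then have step_int: "integrable M (rat_step xs)" if "xs \<in> lists (UNIV \<times> G)" for xs
    using that by (intro integrable_rat_step) (meson Sigma_mono lists_mono order_refl subsetD)
  have appr_lim: "appr g" if g: "integrable M g"
    and lim: "\<And>e. 0 < e \<Longrightarrow> \<exists>k. integrable M k \<and> appr k \<and> (\<integral>x. \<bar>g x - k x\<bar> \<partial>M) < e" for g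
    unfolding appr_def
  proof (intro allI impI)
    fix e :: real assume "0 < e"
    with lim[of "e/2"] obtain k where k: "integrable M k" "appr k" "(\<integral>x. \<bar>g x - k x\<bar> \<partial>M) < e/2" by auto
    with \<open>0 < e\<close> obtain xs where xs: "xs \<in> lists (UNIV \<times> G)" "(\<integral>x. \<bar>k x - rat_step xs x\<bar> \<partial>M) < e/2"
      unfolding appr_def by (meson half_gt_zero)
    have "(\<integral>x. \<bar>g x - rat_step xs x\<bar> \<partial>M) \<le> (\<integral>x. \<bar>g x - k x\<bar> + \<bar>k x - rat_step xs x\<bar> \<partial>M)"
      using g k(1) step_int[OF xs(1)] by (intro integral_mono) auto
    also have "\<dots> = (\<integral>x. \<bar>g x - k x\<bar> \<partial>M) + (\<integral>x. \<bar>k x - rat_step xs x\<bar> \<partial>M)"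
      using g k(1) step_int[OF xs(1)] by (intro Bochner_Integration.integral_add) auto
    finally show "\<exists>xs\<in>lists (UNIV \<times> G). (\<integral>x. \<bar>g x - rat_step xs x\<bar> \<partial>M) < e"
      using k xs by (intro bexI[of _ xs]) auto
  qed
  have appr_add: "appr (\<lambda>x. g x + k x)"
    if g: "integrable M g" "appr g" and k: "integrable M k" "appr k" for g k
    unfolding appr_def
  proof (intro allI impI)
    fix e :: real assume "0 < e"
    with g k obtain xs ys where xs: "xs \<in> lists (UNIV \<times> G)" "(\<integral>x. \<bar>g x - rat_step xs x\<bar> \<partial>M) < e/2"
      and ys: "ys \<in> lists (UNIV \<times> G)" "(\<integral>x. \<bar>k x - rat_step ys x\<bar> \<partial>M) < e/2"
      unfolding appr_def by (meson half_gt_zero)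
    have "(\<integral>x. \<bar>g x + k x - rat_step (xs @ ys) x\<bar> \<partial>M)
        \<le> (\<integral>x. \<bar>g x - rat_step xs x\<bar> + \<bar>k x - rat_step ys x\<bar> \<partial>M)"
      using g k(1) step_int[OF xs(1)] step_int[OF ys(1)]
      by (intro integral_mono) (auto simp: rat_step_simps)
    also have "\<dots> = (\<integral>x. \<bar>g x - rat_step xs x\<bar> \<partial>M) + (\<integral>x. \<bar>k x - rat_step ys x\<bar> \<partial>M)"
      using g k(1) step_int[OF xs(1)] step_int[OF ys(1)]
      by (intro Bochner_Integration.integral_add) auto
    finally show "\<exists>xs\<in>lists (UNIV \<times> G). (\<integral>x. \<bar>g x + k x - rat_step xs x\<bar> \<partial>M) < e"
      using xs ys by (intro bexI[of _ "xs @ ys"]) auto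
  qed
  have appr_rat: "appr (\<lambda>x. of_rat q * g x)" if g: "appr g" for g q
    unfolding appr_def
  proof (intro allI impI)
    fix e :: real assume "0 < e"
    \<comment> \<open>The added 1 keeps the divisor positive when \<open>q = 0\<close>.\<close>
    have q: "0 < \<bar>of_rat q\<bar> + (1::real)" by (intro add_nonneg_pos abs_ge_zero zero_less_one)
    with \<open>0 < e\<close> have "0 < e / (\<bar>of_rat q\<bar> + 1)" by (intro divide_pos_pos)
    with g obtain xs where xs: "xs \<in> lists (UNIV \<times> G)"
      "(\<integral>x. \<bar>g x - rat_step xs x\<bar> \<partial>M) < e / (\<bar>of_rat q\<bar> + 1)"
      unfolding appr_def by meson
    let ?ys = "map (\<lambda>(r, B). (q * r, B)) xs"
    have ys: "?ys \<in> lists (UNIV \<times> G)" using xs(1) by auto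
    have "(\<integral>x. \<bar>of_rat q * g x - rat_step ?ys x\<bar> \<partial>M) = (\<integral>x. \<bar>of_rat q\<bar> * \<bar>g x - rat_step xs x\<bar> \<partial>M)"
      unfolding rat_step_map_mult right_diff_distrib[symmetric] abs_mult ..
    also have "\<dots> \<le> (\<bar>of_rat q\<bar> + 1) * (\<integral>x. \<bar>g x - rat_step xs x\<bar> \<partial>M)"
      by (simp add: mult_right_mono)
    also have "\<dots> < e"
      using xs(2) q by (simp add: pos_less_divide_eq mult.commute)
    finally show "\<exists>xs\<in>lists (UNIV \<times> G). (\<integral>x. \<bar>of_rat q * g x - rat_step xs x\<bar> \<partial>M) < e"
      using ys by blast
  qed
  have appr_scale: "appr (\<lambda>x. c * g x)" if g: "integrable M g" "appr g" for g c
  proof (rule appr_lim)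
    fix e :: real assume "0 < e"
    define I where "I = (\<integral>x. \<bar>g x\<bar> \<partial>M)"
    have "0 \<le> I" by (simp add: I_def)
    then have "0 < e / (I + 1)" using \<open>0 < e\<close> by simp
    \<comment> \<open>A real factor is a limit of rational ones: a rational within
      \<open>e / (I + 1)\<close> of \<open>c\<close> costs less than \<open>e\<close> in L1. The
      added 1 covers \<open>I = 0\<close>.\<close>
    then obtain q where q: "c < of_rat q" "of_rat q < c + e / (I + 1)"
      using of_rat_dense[of c "c + e / (I + 1)"] by auto
    have "(\<integral>x. \<bar>c * g x - of_rat q * g x\<bar> \<partial>M) = \<bar>c - of_rat q\<bar> * I"
      unfolding left_diff_distrib[symmetric] abs_mult I_def by simp
    also have "\<dots> \<le> (e / (I + 1)) * I"
      using q \<open>0 \<le> I\<close> by (intro mult_right_mono) auto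
    also have "\<dots> < e"
      using \<open>0 \<le> I\<close> \<open>0 < e\<close> by (simp add: field_simps)
    finally show "\<exists>k. integrable M k \<and> appr k \<and> (\<integral>x. \<bar>c * g x - k x\<bar> \<partial>M) < e"
      using g appr_rat[of g q] by (intro exI[of _ "\<lambda>x. of_rat q * g x"]) auto
  qed (use g in auto)
  have appr_indicator: "appr (indicator B)" if "B \<in> sigma_sets (space M) G" for B
    using G(1,2) that
  proof (induction rule: sigma_sets_induct_disjoint)
    case (basic B)
    then show ?case
      unfolding appr_def by (auto intro!: bexI[of _ "[(1, B)]"] simp: rat_step_simps)
  next
    case empty
    then show ?case
      unfolding appr_def by (auto intro!: bexI[of _ "[]"] simp: rat_step_simps)
  next
    case (compl B)
    then have B: "B \<in> sets M" using G(3) by simp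
    \<comment> \<open>The complement is handled by subtracting from the indicator of the whole
      space, which is in \<open>G\<close>.\<close>
    have "appr (indicator (space M))"
      unfolding appr_def using G(4)
      by (auto intro!: bexI[of _ "[(1, space M)]"] simp: rat_step_simps)
    then have "appr (\<lambda>x. indicator (space M) x + (- 1) * indicator B x)"
      using B compl by (intro appr_add appr_scale) (auto simp: less_top[symmetric])
    also have "(\<lambda>x. indicator (space M) x + (- 1) * indicator B x) = (indicator (space M - B) :: _ \<Rightarrow> real)"
      using sets.sets_into_space[OF B] by (auto simp: fun_eq_iff split: split_indicator)
    finally show ?case .
  next
    case (union B)
    then have B: "\<And>i. B i \<in> sets M" using G(3) by auto
    \<comment> \<open>Partial unions are sums of disjoint indicators; by continuity from below they
      are L1-close to the whole union.\<close>
    have fin: "appr (indicator (\<Union>i<n. B i))" for n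
    proof (induction n)
      case 0
      then show ?case unfolding appr_def by (auto intro!: bexI[of _ "[]"] simp: rat_step_simps)
    next
      case (Suc n)
      have "appr (\<lambda>x. indicator (\<Union>i<n. B i) x + indicator (B n) x)"
        using B Suc union(3)[of n] by (intro appr_add) (auto simp: less_top[symmetric])
      also have "(\<lambda>x. indicator (\<Union>i<n. B i) x + indicator (B n) x) = (indicator (\<Union>i<Suc n. B i) :: _ \<Rightarrow> real)"
      proof -
        have "B i \<inter> B n = {}" if "i < n" for i
          using disjoint_family_onD[OF union(1), of i n] that by simp
        then have "(\<Union>i<n. B i) \<inter> B n = {}" by blast
        then show ?thesis
          by (auto simp: fun_eq_iff lessThan_Suc split: split_indicator)
      qed
      finally show ?case .
    qed
    have UB: "(\<Union>i. B i) \<in> sets M" using B by auto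
    show ?case
    proof (rule appr_lim)
      fix e :: real assume "0 < e"
      have "(\<lambda>n. measure M (\<Union>i<n. B i)) \<longlonglongrightarrow> measure M (\<Union>n. \<Union>i<n. B i)"
        using B by (intro finite_Lim_measure_incseq) (auto simp: incseq_def, force)
      moreover have "(\<Union>n. \<Union>i<n. B i) = (\<Union>i. B i)" by auto
      ultimately have "\<forall>\<^sub>F n in sequentially. dist (measure M (\<Union>i<n. B i)) (measure M (\<Union>i. B i)) < e"
        using \<open>0 < e\<close> by (simp add: tendsto_iff)
      then obtain n where n: "\<bar>measure M (\<Union>i<n. B i) - measure M (\<Union>i. B i)\<bar> < e"
        by (auto simp: eventually_sequentially dist_real_def)
      have "(\<integral>x. \<bar>indicat_real (\<Union>i. B i) x - indicator (\<Union>i<n. B i) x\<bar> \<partial>M)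
          = (\<integral>x. indicator (\<Union>i. B i) x - indicator (\<Union>i<n. B i) x \<partial>M)"
        by (intro Bochner_Integration.integral_cong) (auto split: split_indicator)
      also have "\<dots> = measure M (\<Union>i. B i) - measure M (\<Union>i<n. B i)"
        using B UB by (subst Bochner_Integration.integral_diff) (auto simp: less_top[symmetric] Int_absorb2 sets.sets_into_space)
      finally show "\<exists>k. integrable M k \<and> appr k \<and> (\<integral>x. \<bar>indicator (\<Union>i. B i) x - k x\<bar> \<partial>M) < e"
        using n fin[of n] B by (intro exI[of _ "indicator (\<Union>i<n. B i)"]) (auto simp: less_top[symmetric])
    qed (use UB in \<open>auto simp: less_top[symmetric]\<close>)
  qed
  from f have "appr f"
  proof (induction rule: integrable_induct)
    case (base A c)
    then have "appr (\<lambda>x. c * indicator A x)"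
      using appr_indicator[of A] G(3) by (intro appr_scale) auto
    then show ?case by (simp add: mult.commute)
  next
    case (add f g)
    then show ?case by (intro appr_add) auto
  next
    case (lim f s)
    show ?case
    proof (rule appr_lim)
      fix e :: real assume "0 < e"
      have "(\<lambda>i. \<integral>x. \<bar>f x - s i x\<bar> \<partial>M) \<longlonglongrightarrow> (\<integral>x. 0 \<partial>M)"
      \<comment> \<open>The simple functions satisfy \<open>|s i x| <= 2 * |f x|\<close>, which
        gives the factor 3 in the majorant.\<close>
      proof (rule integral_dominated_convergence[where w = "\<lambda>x. 3 * \<bar>f x\<bar>"])
        show "AE x in M. (\<lambda>i. \<bar>f x - s i x\<bar>) \<longlonglongrightarrow> 0"
        proof (intro AE_I2)
          fix x assume "x \<in> space M"
          then have "(\<lambda>i. s i x) \<longlonglongrightarrow> f x" by (rule lim)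
          then have "(\<lambda>i. f x - s i x) \<longlonglongrightarrow> f x - f x"
            by (intro tendsto_intros)
          then show "(\<lambda>i. \<bar>f x - s i x\<bar>) \<longlonglongrightarrow> 0"
            by (simp add: tendsto_rabs_zero_iff)
        qed
        show "AE x in M. norm \<bar>f x - s i x\<bar> \<le> 3 * \<bar>f x\<bar>" for i
        proof (intro AE_I2)
          fix x assume "x \<in> space M"
          then have "norm (s i x) \<le> 2 * norm (f x)" by (rule lim)
          then show "norm \<bar>f x - s i x\<bar> \<le> 3 * \<bar>f x\<bar>" by simp
        qed
      qed (use lim in auto)
      then have "\<forall>\<^sub>F i in sequentially. (\<integral>x. \<bar>f x - s i x\<bar> \<partial>M) < e"
        using \<open>0 < e\<close> by (intro order_tendstoD(2)[where y = 0]) auto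
      then obtain i where "(\<integral>x. \<bar>f x - s i x\<bar> \<partial>M) < e"
        by (auto simp: eventually_sequentially)
      then show "\<exists>k. integrable M k \<and> appr k \<and> (\<integral>x. \<bar>f x - k x\<bar> \<partial>M) < e"
        using lim by (intro exI[of _ "s i"]) auto
    qed fact
  qed
  with e show ?thesis by (auto simp: appr_def)
qed

section \<open>A variational formula for the Kullback-Leibler divergence\<close>

text \<open>Domination by \<open>c\<close> times \<open>Q\<close> bounds the Radon-Nikodym
  derivative by \<open>c\<close> almost everywhere; a change on a null set makes the bounds hold
  everywhere.\<close>

lemma bounded_density_exists:
  assumes Q: "prob_space Q" and J: "prob_space J" and sets: "sets J = sets Q"
    and le: "\<And>X. X \<in> sets Q \<Longrightarrow> emeasure J X \<le> ennreal c * emeasure Q X"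
  obtains h :: "'a \<Rightarrow> real" where "h \<in> borel_measurable Q" "\<And>x. 0 \<le> h x" "\<And>x. h x \<le> c" "J = density Q h"
proof -
  interpret Q: prob_space Q by fact
  interpret J: prob_space J by fact
  \<comment> \<open>Comparison of total masses; it makes the later truncation at \<open>c\<close>
    nonnegative.\<close>
  have "1 \<le> ennreal c"
    using le[of "space Q"] Q.emeasure_space_1 J.emeasure_space_1 sets_eq_imp_space_eq[OF sets] by simp
  then have c: "1 \<le> c" by (simp add: ennreal_1[symmetric] ennreal_le_iff2 del: ennreal_1)
  have ac: "absolutely_continuous Q J"
    unfolding absolutely_continuous_def
  proof
    fix X assume "X \<in> null_sets Q"
    then show "X \<in> null_sets J"
      using le[of X] sets by (simp add: null_sets_def)
  qed
  define r where "r = RN_deriv Q J"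
  have r[measurable]: "r \<in> borel_measurable Q" by (simp add: r_def)
  have dr: "density Q r = J" unfolding r_def by (rule Q.density_RN_deriv[OF ac sets])
  \<comment> \<open>The excess of \<open>r\<close> over \<open>c\<close> on \<open>E\<close>
    integrates to \<open>J E - c * Q E\<close>, which is 0 in \<open>ennreal\<close> by domination;
    hence the excess vanishes almost everywhere.\<close>
  define E where "E = {x \<in> space Q. ennreal c < r x}"
  have E[measurable]: "E \<in> sets Q" by (simp add: E_def)
  have "(\<integral>\<^sup>+x. (r x - ennreal c) * indicator E x \<partial>Q) = (\<integral>\<^sup>+x. r x * indicator E x - ennreal c * indicator E x \<partial>Q)"
    by (intro nn_integral_cong) (auto split: split_indicator)
  also have "\<dots> = (\<integral>\<^sup>+x. r x * indicator E x \<partial>Q) - (\<integral>\<^sup>+x. ennreal c * indicator E x \<partial>Q)"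
    by (intro nn_integral_diff)
       (auto simp: E_def nn_integral_cmult_indicator ennreal_mult_eq_top_iff split: split_indicator intro!: AE_I2)
  also have "\<dots> = emeasure J E - ennreal c * emeasure Q E"
    by (subst dr[symmetric]) (simp add: emeasure_density nn_integral_cmult_indicator)
  also have "\<dots> = 0"
    using le[OF E] by (simp add: diff_eq_0_iff_ennreal J.emeasure_finite less_top[symmetric])
  finally have "AE x in Q. (r x - ennreal c) * indicator E x = 0"
    by (subst (asm) nn_integral_0_iff_AE) auto
  then have AE_le: "AE x in Q. r x \<le> ennreal c"
    by (rule AE_mp)
       (auto intro!: AE_I2 simp: E_def diff_eq_0_iff_ennreal not_less split: split_indicator_asm)
  define h where "h x = min c (enn2real (r x))" for x
  show thesis
  proof
    show "h \<in> borel_measurable Q" unfolding h_def by measurable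
    show "0 \<le> h x" "h x \<le> c" for x using c by (auto simp: h_def)
    have "AE x in Q. r x = ennreal (h x)"
      using AE_le
    proof eventually_elim
      case (elim x)
      then have "enn2real (r x) \<le> c" "r x < top"
        using c by (auto simp: enn2real_leI less_top[symmetric] top_unique)
      then show ?case by (simp add: h_def min_absorb2)
    qed
    then show "J = density Q h"
      unfolding dr[symmetric] by (intro density_cong) (auto simp: h_def)
  qed
qed

text \<open>Fenchel-Young inequality: \<open>exp (y - 1)\<close> is the convex conjugate of
  \<open>x * ln x\<close>. It is \<open>1 + t \<le> exp t\<close> at
  \<open>t = y - 1 - ln x\<close>, multiplied by \<open>x\<close>.\<close>

lemma mult_minus_exp_le_mult_ln:
  fixes x y :: real
  assumes "0 \<le> x"
  shows "x * y - exp (y - 1) \<le> x * ln x"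
proof (cases "x = 0")
  case False
  with assms have "0 < x" by simp
  have "x * (1 + (y - 1 - ln x)) \<le> x * exp (y - 1 - ln x)"
    using \<open>0 < x\<close> by (intro mult_left_mono exp_ge_add_one_self) auto
  also have "\<dots> = exp (y - 1)"
    using \<open>0 < x\<close> by (simp add: exp_diff)
  finally show ?thesis by (simp add: algebra_simps)
qed simp

text \<open>The upper bound comes from \<open>ln x \<le> x - 1\<close>, the lower one from
  Fenchel-Young at \<open>y = 0\<close>. The constant is crude; only finiteness matters.\<close>

lemma abs_mult_ln_le:
  fixes x c :: real
  assumes "0 \<le> x" "x \<le> c"
  shows "\<bar>x * ln x\<bar> \<le> 1 + c * c"
proof (cases "x = 0")
  case False
  then have "0 < x" using assms by simp
  have "x * ln x \<le> x * x" using \<open>0 < x\<close> ln_le_minus_one[OF \<open>0 < x\<close>] by (intro mult_left_mono) auto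
  also have "\<dots> \<le> c * c" using assms by (intro mult_mono) auto
  finally have 1: "x * ln x \<le> c * c" .
  have "- exp (- 1) \<le> x * ln x"
    using mult_minus_exp_le_mult_ln[OF assms(1), of 0] by simp
  moreover have "exp (- 1) \<le> (1::real)" by simp
  ultimately have "- (x * ln x) \<le> 1" by linarith
  with 1 show ?thesis by (auto simp: abs_le_iff intro: add_increasing2 add_increasing)
qed simp

section \<open>Divergence of a law with bounded density\<close>

locale bounded_density = prob_space Q for Q :: "'a measure" +
  fixes h :: "'a \<Rightarrow> real" and c :: real
  assumes h_meas[measurable]: "h \<in> borel_measurable Q"
    and h_nonneg: "0 \<le> h x" and h_le: "h x \<le> c"
begin

lemma c_nonneg: "0 \<le> c"
  using h_nonneg[of undefined] h_le[of undefined] by linarith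

lemma KL_eq: "KL_divergence (exp 1) Q (density Q h) = (\<integral>x. h x * ln (h x) \<partial>Q)"
  using h_nonneg by (subst KL_density) (auto simp: log_def)

lemma integrable_h_ln_h: "integrable Q (\<lambda>x. h x * ln (h x))"
  using abs_mult_ln_le[OF h_nonneg h_le] by (intro integrable_const_bound[where B = "1 + c * c"]) auto

lemma KL_bound: "\<bar>KL_divergence (exp 1) Q (density Q h)\<bar> \<le> 1 + c * c"
proof -
  have "\<bar>\<integral>x. h x * ln (h x) \<partial>Q\<bar> \<le> (\<integral>x. \<bar>h x * ln (h x)\<bar> \<partial>Q)"
    by (rule integral_abs_bound)
  also have "\<dots> \<le> (\<integral>x. 1 + c * c \<partial>Q)"
    using integrable_h_ln_h by (intro integral_mono abs_mult_ln_le h_nonneg h_le) auto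
  finally show ?thesis by (simp add: KL_eq prob_space)
qed

lemma integrable_h_mult:
  assumes [measurable]: "f \<in> borel_measurable Q" and f: "\<And>x. x \<in> space Q \<Longrightarrow> \<bar>f x\<bar> \<le> (k::real)"
  shows "integrable Q (\<lambda>x. h x * f x)"
  using f h_nonneg h_le c_nonneg
  by (intro integrable_const_bound[where B = "c * k"] AE_I2) (auto simp: abs_mult intro!: mult_mono)

lemma integrable_exp_bounded:
  assumes [measurable]: "f \<in> borel_measurable Q" and f: "\<And>x. x \<in> space Q \<Longrightarrow> \<bar>f x\<bar> \<le> (k::real)"
  shows "integrable Q (\<lambda>x. exp (f x - 1))"
  using f by (intro integrable_const_bound[where B = "exp k"] AE_I2) (auto, fastforce simp: abs_le_iff)

lemma integral_density_h:
  assumes [measurable]: "f \<in> borel_measurable Q"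
  shows "(\<integral>x. f x \<partial>density Q h) = (\<integral>x. h x * f x \<partial>Q)"
  using h_nonneg by (subst integral_real_density) auto

text \<open>The Fenchel-Young inequality at \<open>x = h\<close> and \<open>y = f\<close>,
  integrated against \<open>Q\<close>.\<close>

lemma variational_le_KL:
  assumes [measurable]: "f \<in> borel_measurable Q" and f: "\<And>x. x \<in> space Q \<Longrightarrow> \<bar>f x\<bar> \<le> (k::real)"
  shows "(\<integral>x. f x \<partial>density Q h) - (\<integral>x. exp (f x - 1) \<partial>Q) \<le> KL_divergence (exp 1) Q (density Q h)"
proof -
  have "(\<integral>x. f x \<partial>density Q h) - (\<integral>x. exp (f x - 1) \<partial>Q) = (\<integral>x. h x * f x - exp (f x - 1) \<partial>Q)"
    using integrable_h_mult[OF assms] integrable_exp_bounded[OF assms] by (simp add: integral_density_h)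
  also have "\<dots> \<le> (\<integral>x. h x * ln (h x) \<partial>Q)"
    using integrable_h_mult[OF assms] integrable_exp_bounded[OF assms] integrable_h_ln_h
    by (intro integral_mono mult_minus_exp_le_mult_ln h_nonneg) auto
  finally show ?thesis by (simp add: KL_eq)
qed

text \<open>The supremum in the variational formula is attained at \<open>f = 1 + ln h\<close>; truncating \<open>h\<close> away from
  \<open>0\<close> keeps \<open>f\<close> bounded at a small cost.\<close>

lemma variational_near_KL:
  assumes "0 < e"
  shows "\<exists>f k. f \<in> borel_measurable Q \<and> (\<forall>x. \<bar>f x\<bar> \<le> real k) \<and>
    KL_divergence (exp 1) Q (density Q h) - e
      \<le> (\<integral>x. f x \<partial>density Q h) - (\<integral>x. exp (f x - 1) \<partial>Q)"
proof -
  define f where "f x = 1 + ln (max (h x) e)" for x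
  obtain k where k: "1 + \<bar>ln e\<bar> + \<bar>ln (max c e)\<bar> \<le> real k" using real_arch_simple by blast
  have f[measurable]: "f \<in> borel_measurable Q" unfolding f_def by measurable
  have bnd: "\<bar>f x\<bar> \<le> real k" for x
  proof -
    have "ln e \<le> ln (max (h x) e)" "ln (max (h x) e) \<le> ln (max c e)"
      using assms h_le[of x] by (auto simp: max_def)
    then show ?thesis using k by (auto simp: f_def)
  qed
  have "(\<integral>x. h x * ln (h x) \<partial>Q) - e = (\<integral>x. h x * ln (h x) - e \<partial>Q)"
    using integrable_h_ln_h prob_space by simp
  also have "\<dots> \<le> (\<integral>x. h x * f x - exp (f x - 1) \<partial>Q)"
  proof (rule integral_mono)
    fix x
    have "h x * ln (h x) \<le> h x * ln (max (h x) e)"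
      using h_nonneg[of x] assms by (cases "h x = 0") (auto intro!: mult_left_mono)
    \<comment> \<open>Here \<open>exp (f x - 1) = max (h x) e \<le> h x + e\<close>, so the
      truncation costs at most \<open>e\<close>.\<close>
    then show "h x * ln (h x) - e \<le> h x * f x - exp (f x - 1)"
      using h_nonneg[of x] assms by (auto simp: f_def algebra_simps max_def)
  qed (use integrable_h_mult[OF f bnd] integrable_exp_bounded[OF f bnd] integrable_h_ln_h in auto)
  also have "\<dots> = (\<integral>x. f x \<partial>density Q h) - (\<integral>x. exp (f x - 1) \<partial>Q)"
    using integrable_h_mult[OF f bnd] integrable_exp_bounded[OF f bnd] by (simp add: integral_density_h)
  finally show ?thesis using f bnd unfolding KL_eq by blast
qed

text \<open>This transfers near-optimality from a measurable function to an L1-close step function.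
  The bound \<open>c\<close> on the density controls the linear term, and \<open>exp k\<close> is a
  Lipschitz constant of the exponential on arguments at most \<open>k\<close>.\<close>

lemma variational_L1_continuous:
  assumes f[measurable]: "f \<in> borel_measurable Q" and fk: "\<And>x. x \<in> space Q \<Longrightarrow> \<bar>f x\<bar> \<le> (k::real)"
    and g[measurable]: "g \<in> borel_measurable Q" and gk: "\<And>x. x \<in> space Q \<Longrightarrow> \<bar>g x\<bar> \<le> (k::real)"
  shows "\<bar>((\<integral>x. f x \<partial>density Q h) - (\<integral>x. exp (f x - 1) \<partial>Q))
        - ((\<integral>x. g x \<partial>density Q h) - (\<integral>x. exp (g x - 1) \<partial>Q))\<bar>
      \<le> (c + exp k) * (\<integral>x. \<bar>f x - g x\<bar> \<partial>Q)"
proof -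
  have exp_lip: "exp a - exp b \<le> exp K * \<bar>a - b\<bar>" if "a \<le> K" "b \<le> K" for a b K :: real
  proof (cases "b \<le> a")
    case True
    have "exp a - exp b = exp a * (1 - exp (b - a))" by (simp add: right_diff_distrib exp_diff)
    also have "\<dots> \<le> exp a * (a - b)"
      using exp_ge_add_one_self[of "b - a"] by (intro mult_left_mono) (linarith, simp)
    also have "\<dots> \<le> exp K * (a - b)" using that True by (intro mult_right_mono) auto
    finally show ?thesis using True by simp
  next
    case False
    then have "exp a - exp b \<le> 0" by simp
    also have "0 \<le> exp K * \<bar>a - b\<bar>" by simp
    finally show ?thesis .
  qed
  note ints = integrable_h_mult[OF f fk] integrable_exp_bounded[OF f fk]
     integrable_h_mult[OF g gk] integrable_exp_bounded[OF g gk]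
  have fi: "integrable Q f" "integrable Q g"
    using fk gk by (auto intro!: integrable_const_bound[where B = k])
  have "((\<integral>x. f x \<partial>density Q h) - (\<integral>x. exp (f x - 1) \<partial>Q))
        - ((\<integral>x. g x \<partial>density Q h) - (\<integral>x. exp (g x - 1) \<partial>Q))
      = (\<integral>x. h x * (f x - g x) - (exp (f x - 1) - exp (g x - 1)) \<partial>Q)"
    using ints by (simp add: integral_density_h right_diff_distrib)
  also have "\<bar>\<dots>\<bar> \<le> (\<integral>x. \<bar>h x * (f x - g x) - (exp (f x - 1) - exp (g x - 1))\<bar> \<partial>Q)"
    by (rule integral_abs_bound)
  also have "\<dots> \<le> (\<integral>x. (c + exp k) * \<bar>f x - g x\<bar> \<partial>Q)"
  proof (rule integral_mono)
    fix x assume x: "x \<in> space Q"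
    have "\<bar>h x * (f x - g x)\<bar> \<le> c * \<bar>f x - g x\<bar>"
      using h_nonneg[of x] h_le[of x] by (simp add: abs_mult mult_right_mono)
    moreover have "\<bar>exp (f x - 1) - exp (g x - 1)\<bar> \<le> exp k * \<bar>f x - g x\<bar>"
      using exp_lip[of "f x - 1" k "g x - 1"] exp_lip[of "g x - 1" k "f x - 1"] fk[OF x] gk[OF x]
      by (auto simp: abs_le_iff abs_minus_commute)
    ultimately show "\<bar>h x * (f x - g x) - (exp (f x - 1) - exp (g x - 1))\<bar> \<le> (c + exp k) * \<bar>f x - g x\<bar>"
      unfolding distrib_right by linarith
  qed (use ints fi in \<open>auto simp: right_diff_distrib\<close>)
  finally show ?thesis by simp
qed

text \<open>For \<open>f = 1 + t * (g - \<mu>) - t^2 / 8\<close>, with \<open>\<mu>\<close> the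
  \<open>Q\<close>-mean of \<open>g\<close>, Hoeffding's lemma bounds the integral of
  \<open>exp (f - 1)\<close> by 1. The variational inequality then gives
  \<open>t * \<delta> - t^2 / 8 \<le> KL\<close> for the difference \<open>\<delta>\<close> of the
  means.\<close>

lemma pinsker_bounded:
  assumes g[measurable]: "g \<in> borel_measurable Q" and g01: "\<And>x. x \<in> space Q \<Longrightarrow> 0 \<le> g x \<and> g x \<le> (1::real)"
    and dens: "prob_space (density Q h)"
  shows "\<bar>(\<integral>x. g x \<partial>density Q h) - (\<integral>x. g x \<partial>Q)\<bar>
    \<le> sqrt (KL_divergence (exp 1) Q (density Q h) / 2)"
proof -
  interpret D: prob_space "density Q h" by fact
  have one_sided: "2 * ((\<integral>x. g x \<partial>density Q h) - (\<integral>x. g x \<partial>Q))\<^sup>2 \<le> KL_divergence (exp 1) Q (density Q h)"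
    if [measurable]: "g \<in> borel_measurable Q" and g01: "\<And>x. x \<in> space Q \<Longrightarrow> 0 \<le> g x \<and> g x \<le> (1::real)"
      and pos: "0 \<le> (\<integral>x. g x \<partial>density Q h) - (\<integral>x. g x \<partial>Q)" for g
  proof -
    define \<mu> where "\<mu> = (\<integral>x. g x \<partial>Q)"
    define \<delta> where "\<delta> = (\<integral>x. g x \<partial>density Q h) - \<mu>"
    \<comment> \<open>The maximizer of \<open>t * \<delta> - t^2 / 8\<close>; the maximum is
      \<open>2 * \<delta>^2\<close>.\<close>
    define t where "t = 4 * \<delta>"
    have "0 \<le> \<delta>" using pos by (simp add: \<delta>_def \<mu>_def)
    interpret B: interval_bounded_random_variable Q g 0 1
      by standard (use g01 in auto)
    have gD: "integrable (density Q h) g"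
      using g01 by (intro D.integrable_const_bound[where B = 1]) (auto intro!: AE_I2)
    have "0 \<le> \<mu>" unfolding \<mu>_def using g01 by (intro integral_nonneg_AE AE_I2) auto
    moreover have "\<mu> \<le> 1"
      using B.integrable g01 integral_mono[of Q g "\<lambda>_. 1"] by (simp add: \<mu>_def prob_space)
    ultimately have "\<bar>\<mu>\<bar> \<le> 1" by simp
    have hoeff: "(\<integral>x. exp (t * (g x - \<mu>)) \<partial>Q) \<le> exp (t\<^sup>2 / 8)"
    \<comment> \<open>Hoeffding's lemma is used for \<open>0 < t\<close>; for
      \<open>\<delta> = 0\<close> both sides equal 1.\<close>
    proof (cases "\<delta> = 0")
      case True
      then show ?thesis by (simp add: t_def prob_space)
    next
      case False
      then have "0 < t" using \<open>0 \<le> \<delta>\<close> by (simp add: t_def)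
      then have "(\<integral>\<^sup>+x. ennreal (exp (t * (g x - \<mu>))) \<partial>Q) \<le> ennreal (exp (t\<^sup>2 / 8))"
        using B.Hoeffdings_lemma_nn_integral[of t] by (simp add: \<mu>_def)
      then show ?thesis
        by (subst integral_eq_nn_integral) (auto simp: enn2real_leI)
    qed
    define f where "f x = 1 + t * (g x - \<mu>) - t\<^sup>2 / 8" for x
    have [measurable]: "f \<in> borel_measurable Q" unfolding f_def by measurable
    have fb: "\<bar>f x\<bar> \<le> 1 + \<bar>t\<bar> * 2 + t\<^sup>2 / 8" if "x \<in> space Q" for x
    proof -
      have "\<bar>t * (g x - \<mu>)\<bar> \<le> \<bar>t\<bar> * 2"
        unfolding abs_mult using g01[OF that] \<open>\<bar>\<mu>\<bar> \<le> 1\<close> by (intro mult_left_mono) auto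
      moreover have "0 \<le> t\<^sup>2 / 8" by simp
      ultimately show ?thesis unfolding f_def by linarith
    qed
    have exp_f: "exp (f x - 1) = exp (- (t\<^sup>2 / 8)) * exp (t * (g x - \<mu>))" for x
      by (simp add: f_def mult_exp_exp)
    have "(\<integral>x. f x \<partial>density Q h) = 1 + t * \<delta> - t\<^sup>2 / 8"
      using gD D.prob_space by (simp add: f_def \<delta>_def)
    moreover have "(\<integral>x. exp (f x - 1) \<partial>Q) = exp (- (t\<^sup>2 / 8)) * (\<integral>x. exp (t * (g x - \<mu>)) \<partial>Q)"
      unfolding exp_f by simp
    moreover have "\<dots> \<le> exp (- (t\<^sup>2 / 8)) * exp (t\<^sup>2 / 8)"
      using hoeff by (intro mult_left_mono) auto
    ultimately have "t * \<delta> - t\<^sup>2 / 8 \<le> KL_divergence (exp 1) Q (density Q h)"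
      using variational_le_KL[of f, OF _ fb] by (simp add: mult_exp_exp)
    also have "t * \<delta> - t\<^sup>2 / 8 = 2 * \<delta>\<^sup>2" by (simp add: t_def power2_eq_square)
    finally show ?thesis by (simp add: \<delta>_def \<mu>_def)
  qed
  have gi: "integrable Q g" "integrable (density Q h) g"
    using g01 by (auto intro!: integrable_const_bound[where B = 1] D.integrable_const_bound[where B = 1] AE_I2)
  have "2 * ((\<integral>x. g x \<partial>density Q h) - (\<integral>x. g x \<partial>Q))\<^sup>2 \<le> KL_divergence (exp 1) Q (density Q h)"
  proof (cases "0 \<le> (\<integral>x. g x \<partial>density Q h) - (\<integral>x. g x \<partial>Q)")
    case True
    with one_sided[of g] g01 show ?thesis by auto
  next
    case False
    \<comment> \<open>Passing to \<open>1 - g\<close> flips the sign of the difference and preserves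
      the range.\<close>
    have "(\<integral>x. 1 - g x \<partial>density Q h) = 1 - (\<integral>x. g x \<partial>density Q h)" "(\<integral>x. 1 - g x \<partial>Q) = 1 - (\<integral>x. g x \<partial>Q)"
      using gi D.prob_space by (simp_all add: prob_space)
    with one_sided[of "\<lambda>x. 1 - g x"] g01 False show ?thesis
      by (auto simp: power2_commute)
  qed
  then show ?thesis
    by (intro real_le_rsqrt) (simp add: power2_abs)
qed

end

section \<open>Measurability of the divergence of two kernels\<close>

definition countably_generated :: "'a measure \<Rightarrow> bool" where
  "countably_generated M \<longleftrightarrow>
     (\<exists>G. countable G \<and> G \<subseteq> Pow (space M) \<and> sets M = sigma_sets (space M) G)"

text \<open>Closing a countable generator under finite intersections keeps it countable. The
  intersection over the empty family, cut down to \<open>space M\<close>, supplies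
  \<open>space M\<close> itself.\<close>

lemma countably_generated_Int_stable:
  assumes "countably_generated M"
  obtains G where "countable G" "G \<subseteq> Pow (space M)" "sets M = sigma_sets (space M) G"
    "Int_stable G" "space M \<in> G"
proof -
  obtain G where G: "countable G" "G \<subseteq> Pow (space M)" "sets M = sigma_sets (space M) G"
    using assms by (auto simp: countably_generated_def)
  define H where "H = (\<lambda>F. \<Inter>F \<inter> space M) ` {F. finite F \<and> F \<subseteq> G}"
  show thesis
  proof
    show "countable H"
      unfolding H_def using G(1) by (intro countable_image countable_Collect_finite_subset)
    show H: "H \<subseteq> Pow (space M)" by (auto simp: H_def)
    have "G \<subseteq> sets M" using G(3) by auto
    then have HM: "H \<subseteq> sets M"
    proof (clarsimp simp: H_def)
      fix F assume F: "finite F" "F \<subseteq> G"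
      then show "\<Inter>F \<inter> space M \<in> sets M"
        using \<open>G \<subseteq> sets M\<close>
        by (induction F rule: finite_induct) (auto simp: Int_assoc)
    qed
    have GH: "G \<subseteq> H"
    proof
      fix B assume "B \<in> G"
      then show "B \<in> H"
        unfolding H_def using G(2) by (intro image_eqI[of _ _ "{B}"]) auto
    qed
    show "sets M = sigma_sets (space M) H"
    proof
      show "sets M \<subseteq> sigma_sets (space M) H"
        unfolding G(3) by (intro sigma_sets_mono' GH)
      show "sigma_sets (space M) H \<subseteq> sets M"
        using HM by (rule sets.sigma_sets_subset)
    qed
    show "Int_stable H"
      unfolding Int_stable_def H_def
    proof (clarsimp simp: image_iff)
      fix E F assume "finite E" "E \<subseteq> G" "finite F" "F \<subseteq> G"
      then show "\<exists>D. finite D \<and> D \<subseteq> G \<and> \<Inter>E \<inter> space M \<inter> (\<Inter>F \<inter> space M) = \<Inter>D \<inter> space M"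
        by (intro exI[of _ "E \<union> F"]) auto
    qed
    show "space M \<in> H"
      unfolding H_def by (intro image_eqI[of _ _ "{}"]) auto
  qed
qed

section \<open>Examples and stability of countable generation\<close>

lemma countably_generated_borel:
  "countably_generated (borel :: 'a::second_countable_topology measure)"
proof -
  obtain B :: "'a set set" where "countable B" "topological_basis B"
    using ex_countable_basis by blast
  then have "sets borel = sets (sigma UNIV B)"
    using borel_eq_countable_basis by metis
  then show ?thesis
    using \<open>countable B\<close> by (auto simp: countably_generated_def)
qed

lemma countably_generated_count_space:
  assumes "countable A"
  shows "countably_generated (count_space A)"
  unfolding countably_generated_def
proof (intro exI conjI)
  show "countable ((\<lambda>a. {a}) ` A)" using assms by simp
  show "sets (count_space A) = sigma_sets (space (count_space A)) ((\<lambda>a. {a}) ` A)"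
  proof
    show "sigma_sets (space (count_space A)) ((\<lambda>a. {a}) ` A) \<subseteq> sets (count_space A)"
      by (rule sets.sigma_sets_subset) auto
    show "sets (count_space A) \<subseteq> sigma_sets (space (count_space A)) ((\<lambda>a. {a}) ` A)"
    proof
      fix X assume "X \<in> sets (count_space A)"
      then have X: "X \<subseteq> A" by simp
      have "(\<Union>a\<in>X. {a}) \<in> sigma_sets (space (count_space A)) ((\<lambda>a. {a}) ` A)"
        using X countable_subset[OF X assms] by (intro sigma_sets_UNION) auto
      then show "X \<in> sigma_sets (space (count_space A)) ((\<lambda>a. {a}) ` A)" by simp
    qed
  qed
qed auto

text \<open>Generating a sigma-algebra commutes with preimages, here under the inclusion, so the
  traces of the generators generate the trace on any set \<open>A\<close>.\<close>

lemma countably_generated_restrict_space: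
  assumes "countably_generated M"
  shows "countably_generated (restrict_space M A)"
proof -
  obtain G where G: "countable G" "G \<subseteq> Pow (space M)" "sets M = sigma_sets (space M) G"
    using assms by (auto simp: countably_generated_def)
  have "sets (restrict_space M A) = {(\<lambda>x. x) -` B \<inter> (A \<inter> space M) |B. B \<in> sigma_sets (space M) G}"
    by (auto simp: sets_restrict_space G(3)[symmetric] dest: sets.sets_into_space)
  also have "\<dots> = sigma_sets (A \<inter> space M) {(\<lambda>x. x) -` B \<inter> (A \<inter> space M) |B. B \<in> G}"
    by (rule sigma_sets_vimage_commute) auto
  finally show ?thesis
    unfolding countably_generated_def using G(1)
    by (intro exI[of _ "{(\<lambda>x. x) -` B \<inter> (A \<inter> space M) |B. B \<in> G}"])
       (auto simp: space_restrict_space2 space_restrict_space Setcompr_eq_image)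
qed

text \<open>Rectangles of generators generate the product because both generators contain their
  whole space.\<close>

lemma countably_generated_pair:
  assumes "countably_generated M" "countably_generated N"
  shows "countably_generated (M \<Otimes>\<^sub>M N)"
proof -
  obtain G where G: "countable G" "G \<subseteq> Pow (space M)" "sets M = sigma_sets (space M) G" "space M \<in> G"
    using countably_generated_Int_stable[OF assms(1)] by metis
  obtain H where H: "countable H" "H \<subseteq> Pow (space N)" "sets N = sigma_sets (space N) H" "space N \<in> H"
    using countably_generated_Int_stable[OF assms(2)] by metis
  have "sets (M \<Otimes>\<^sub>M N) = sets (sigma (space M \<times> space N) {a \<times> b |a b. a \<in> G \<and> b \<in> H})"
    using G H by (intro sets_pair_eq[of G M "{space M}" H N "{space N}"]) auto
  also have "\<dots> = sigma_sets (space M \<times> space N) {a \<times> b |a b. a \<in> G \<and> b \<in> H}"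
    using G(2) H(2) by (intro sets_measure_of) auto
  finally have "sets (M \<Otimes>\<^sub>M N) = sigma_sets (space (M \<Otimes>\<^sub>M N)) {a \<times> b |a b. a \<in> G \<and> b \<in> H}"
    by (simp add: space_pair_measure)
  moreover have "{a \<times> b |a b. a \<in> G \<and> b \<in> H} = (\<lambda>(a, b). a \<times> b) ` (G \<times> H)" by auto
  then have "countable {a \<times> b |a b. a \<in> G \<and> b \<in> H}"
    using G(1) H(1) by auto
  moreover have "{a \<times> b |a b. a \<in> G \<and> b \<in> H} \<subseteq> Pow (space (M \<Otimes>\<^sub>M N))"
    using G(2) H(2) by (auto simp: space_pair_measure)
  ultimately show ?thesis
    unfolding countably_generated_def by blast
qed

text \<open>The divergence is a supremum of functionals \<open>V i\<close>, each measurable in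
  \<open>z\<close> as a difference of kernel integrals. Countable generation makes countably many of
  them enough, through the density of step functions.\<close>

lemma borel_measurable_KL_divergence:
  fixes M :: "'a measure"
  assumes cg: "countably_generated M"
    and Q: "Q \<in> N \<rightarrow>\<^sub>M prob_algebra M" and J: "J \<in> N \<rightarrow>\<^sub>M prob_algebra M"
    and le: "\<And>z X. z \<in> space N \<Longrightarrow> X \<in> sets M \<Longrightarrow> emeasure (J z) X \<le> ennreal c * emeasure (Q z) X"
  shows "(\<lambda>z. KL_divergence (exp 1) (Q z) (J z)) \<in> borel_measurable N"
proof -
  obtain G where G: "countable G" "G \<subseteq> Pow (space M)" "sets M = sigma_sets (space M) G"
    "Int_stable G" "space M \<in> G"
    using countably_generated_Int_stable[OF cg] .
  \<comment> \<open>An index is a clamping level with a step function; clamping gives the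
    boundedness that the variational inequality asks for.\<close>
  define I where "I = (UNIV :: nat set) \<times> lists ((UNIV :: rat set) \<times> G)"
  define F where "F i x = max (- real (fst i)) (min (real (fst i)) (rat_step (snd i) x))"
    for i :: "nat \<times> (rat \<times> 'a set) list" and x
  define V where "V i z = (\<integral>x. F i x \<partial>J z) - (\<integral>x. exp (F i x - 1) \<partial>Q z)" for i z
  have "countable I" using G(1) unfolding I_def by auto
  have "G \<subseteq> sets M" using G(3) by auto
  then have GM: "lists ((UNIV :: rat set) \<times> G) \<subseteq> lists (UNIV \<times> sets M)"
    by (intro lists_mono Sigma_mono) auto
  have F_meas: "F i \<in> borel_measurable M" if "i \<in> I" for i
  proof -
    have "snd i \<in> lists (UNIV \<times> sets M)"
      using that GM unfolding I_def by (metis mem_Times_iff subsetD)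
    then have [measurable]: "rat_step (snd i) \<in> borel_measurable M" by (rule borel_measurable_rat_step)
    show ?thesis unfolding F_def[abs_def] by measurable
  qed
  have F_bound: "\<bar>F i x\<bar> \<le> real (fst i)" for i x
    unfolding F_def by auto
  have V_meas: "V i \<in> borel_measurable N" if "i \<in> I" for i
  proof -
    note F_meas[OF that, measurable]
    note measurable_prob_algebraD[OF Q, measurable] measurable_prob_algebraD[OF J, measurable]
    show ?thesis
      unfolding V_def[abs_def] by measurable
  qed
  have KL: "V i z \<le> KL_divergence (exp 1) (Q z) (J z)"
    "0 < e \<Longrightarrow> \<exists>i\<in>I. KL_divergence (exp 1) (Q z) (J z) - e < V i z"
    if z: "z \<in> space N" and i: "i \<in> I" for z i e
  proof -
    have Qz: "prob_space (Q z)" "sets (Q z) = sets M" and Jz: "prob_space (J z)" "sets (J z) = sets M"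
      using measurable_space[OF Q z] measurable_space[OF J z] by (auto simp: space_prob_algebra)
    have spQ: "space (Q z) = space M" using Qz(2) by (rule sets_eq_imp_space_eq)
    obtain h where h: "h \<in> borel_measurable (Q z)" "\<And>x. 0 \<le> h x" "\<And>x. h x \<le> c" "J z = density (Q z) h"
      using bounded_density_exists[OF Qz(1) Jz(1), of c] le[OF z] Qz(2) Jz(2) by auto
    interpret bounded_density "Q z" h c
      using Qz(1) h by (simp add: bounded_density_def bounded_density_axioms_def)
    have FQ: "F i \<in> borel_measurable (Q z)" if "i \<in> I" for i
      using F_meas[OF that] measurable_cong_sets[OF Qz(2) refl] by blast
    show "V i z \<le> KL_divergence (exp 1) (Q z) (J z)"
      unfolding V_def h(4) using variational_le_KL[OF FQ[OF i] F_bound] .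
    show "\<exists>i\<in>I. KL_divergence (exp 1) (Q z) (J z) - e < V i z" if "0 < e"
    proof -
      obtain f k where f: "f \<in> borel_measurable (Q z)" "\<And>x. \<bar>f x\<bar> \<le> real k"
        "KL_divergence (exp 1) (Q z) (J z) - e / 2 \<le> (\<integral>x. f x \<partial>J z) - (\<integral>x. exp (f x - 1) \<partial>Q z)"
        using variational_near_KL[of "e / 2"] \<open>0 < e\<close> unfolding h(4) by auto
      \<comment> \<open>The Lipschitz constant of the functional at level \<open>k\<close>: an L1
        error below \<open>e / (2 * L)\<close> costs less than \<open>e / 2\<close>, and the other
        half of \<open>e\<close> pays for the choice of \<open>f\<close>.\<close>
      define L where "L = c + exp (real k)"
      have "0 < L" unfolding L_def using c_nonneg by (simp add: add_nonneg_pos)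
      have fi: "integrable (Q z) f"
        using f by (intro integrable_const_bound[where B = "real k"]) auto
      obtain xs where xs: "xs \<in> lists (UNIV \<times> G)" "(\<integral>x. \<bar>f x - rat_step xs x\<bar> \<partial>Q z) < e / (2 * L)"
        using rat_step_dense_L1[of G f "e / (2 * L)"] G(2,3,4,5) Qz(2) spQ fi \<open>0 < e\<close> \<open>0 < L\<close> by auto
      have iI: "(k, xs) \<in> I" using xs(1) by (simp add: I_def)
      have ri: "integrable (Q z) (rat_step xs)"
        using subsetD[OF GM xs(1)] Qz(2) by (intro integrable_rat_step) metis
      have Fi: "integrable (Q z) (F (k, xs))"
        using FQ[OF iI] F_bound[of "(k, xs)"] by (intro integrable_const_bound[where B = "real k"]) auto
      have "\<bar>((\<integral>x. f x \<partial>J z) - (\<integral>x. exp (f x - 1) \<partial>Q z)) - V (k, xs) z\<bar>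
          \<le> L * (\<integral>x. \<bar>f x - F (k, xs) x\<bar> \<partial>Q z)"
        using variational_L1_continuous[OF f(1,2) FQ[OF iI]] F_bound[of "(k, xs)"]
        unfolding V_def h(4) L_def by simp
      also have "\<dots> \<le> L * (\<integral>x. \<bar>f x - rat_step xs x\<bar> \<partial>Q z)"
      proof (intro mult_left_mono integral_mono)
        fix x
        \<comment> \<open>Clamping to \<open>[-k, k]\<close> cannot increase the distance to
          \<open>f x\<close>, which already lies in that interval.\<close>
        show "\<bar>f x - F (k, xs) x\<bar> \<le> \<bar>f x - rat_step xs x\<bar>"
          using f(2)[of x] by (auto simp: F_def)
      qed (use \<open>0 < L\<close> ri Fi fi in auto)
      also have "\<dots> < L * (e / (2 * L))"
        using xs(2) \<open>0 < L\<close> by (intro mult_strict_left_mono) auto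
      also have "\<dots> = e / 2" using \<open>0 < L\<close> by simp
      finally have "KL_divergence (exp 1) (Q z) (J z) - e < V (k, xs) z"
        using f(3) by linarith
      with iI show ?thesis by blast
    qed
  qed
  \<comment> \<open>A supremum of reals is meaningful only over a nonempty bounded family: this
    index gives nonemptiness, the divergence itself the upper bound.\<close>
  have "(0, []) \<in> I" by (simp add: I_def)
  have bdd: "bdd_above ((\<lambda>i. V i z) ` I)" if "z \<in> space N" for z
    using KL(1)[OF that] by (auto intro!: bdd_aboveI[of _ "KL_divergence (exp 1) (Q z) (J z)"])
  have "(\<lambda>z. SUP i\<in>I. V i z) \<in> borel_measurable N"
    using \<open>countable I\<close> V_meas bdd by (rule borel_measurable_cSUP)
  moreover have "KL_divergence (exp 1) (Q z) (J z) = (SUP i\<in>I. V i z)" if z: "z \<in> space N" for z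
  proof (rule antisym)
    show "(SUP i\<in>I. V i z) \<le> KL_divergence (exp 1) (Q z) (J z)"
      using \<open>(0, []) \<in> I\<close> KL(1)[OF z] by (intro cSUP_least) auto
    show "KL_divergence (exp 1) (Q z) (J z) \<le> (SUP i\<in>I. V i z)"
    proof (rule field_le_epsilon)
      fix e :: real assume "0 < e"
      then obtain i where i: "i \<in> I" "KL_divergence (exp 1) (Q z) (J z) - e < V i z"
        using KL(2)[OF z \<open>(0, []) \<in> I\<close>] by blast
      with cSUP_upper[OF i(1) bdd[OF z]] show "KL_divergence (exp 1) (Q z) (J z) \<le> (SUP i\<in>I. V i z) + e"
        by linarith
    qed
  qed
  ultimately show ?thesis by (simp cong: measurable_cong)
qed

section \<open>A uniformly chosen index and its noisy observation\<close>

lemma uniform_count_measure_in_prob_algebra: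
  assumes "finite A" "A \<noteq> {}"
  shows "uniform_count_measure A \<in> space (prob_algebra (count_space A))"
  using prob_space_uniform_count_measure[OF assms]
  by (simp add: space_prob_algebra sets_uniform_count_measure)

text \<open>The form of \<open>loo_joint\<close> for an arbitrary family \<open>B\<close>, so that
  the information-theoretic part concerns \<open>n\<close> probability measures and no data.\<close>

definition uniform_mixture :: "nat \<Rightarrow> 'w measure \<Rightarrow> (nat \<Rightarrow> 'w measure) \<Rightarrow> (nat \<times> 'w) measure" where
  "uniform_mixture n Wm B =
     uniform_count_measure {..<n} \<bind>
       (\<lambda>u. B u \<bind> (\<lambda>w. return (count_space {..<n} \<Otimes>\<^sub>M Wm) (u, w)))"

lemma loo_joint_eq_uniform_mixture:
  "loo_joint n Wm A z = uniform_mixture n Wm (\<lambda>u. A (loo_delete n u z))"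
  by (simp add: loo_joint_def uniform_mixture_def)

locale uniform_mixture_kernel =
  fixes n :: nat and Wm :: "'w measure" and B :: "nat \<Rightarrow> 'w measure"
  assumes n_pos: "0 < n"
    and B_prob: "u < n \<Longrightarrow> prob_space (B u)"
    and B_sets: "u < n \<Longrightarrow> sets (B u) = sets Wm"
begin

abbreviation "C \<equiv> count_space {..<n}"
abbreviation "mix \<equiv> uniform_mixture n Wm B"
text \<open>The mutual information is taken with \<open>snd\<close> before \<open>fst\<close>, so
  the pair is swapped to live on \<open>Wm \<Otimes>\<^sub>M C\<close>, as does
  \<open>indep\<close>.\<close>

abbreviation "joint \<equiv> distr mix (Wm \<Otimes>\<^sub>M C) (\<lambda>x. (snd x, fst x))"
abbreviation "indep \<equiv> distr mix Wm snd \<Otimes>\<^sub>M distr mix C fst"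

lemma uniform_in_prob_algebra: "uniform_count_measure {..<n} \<in> space (prob_algebra C)"
  using n_pos by (intro uniform_count_measure_in_prob_algebra) (auto simp: lessThan_empty_iff)

lemma measurable_Pair_B:
  assumes "u < n"
  shows "Pair u \<in> B u \<rightarrow>\<^sub>M C \<Otimes>\<^sub>M Wm"
  unfolding measurable_cong_sets[OF B_sets[OF assms] refl]
  using assms by (intro measurable_Pair1') simp

lemma bind_B_eq_distr:
  assumes "u < n"
  shows "B u \<bind> (\<lambda>w. return (C \<Otimes>\<^sub>M Wm) (u, w)) = distr (B u) (C \<Otimes>\<^sub>M Wm) (Pair u)"
proof -
  have "space (B u) \<noteq> {}" using prob_space.not_empty[OF B_prob[OF assms]] .
  with measurable_Pair_B[OF assms] show ?thesis
    using bind_return_distr[of "B u" "Pair u" "C \<Otimes>\<^sub>M Wm"] by (simp add: comp_def)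
qed

lemma kernel_measurable:
  "(\<lambda>u. B u \<bind> (\<lambda>w. return (C \<Otimes>\<^sub>M Wm) (u, w))) \<in> C \<rightarrow>\<^sub>M prob_algebra (C \<Otimes>\<^sub>M Wm)"
  using B_prob prob_space.prob_space_distr[OF B_prob measurable_Pair_B]
  by (auto simp: space_prob_algebra bind_B_eq_distr)

lemma mix_in_prob_algebra: "mix \<in> space (prob_algebra (C \<Otimes>\<^sub>M Wm))"
  using prob_space_bind'[OF uniform_in_prob_algebra kernel_measurable]
    sets_bind'[OF uniform_in_prob_algebra kernel_measurable]
  by (simp add: space_prob_algebra uniform_mixture_def)

lemma sets_mix [measurable_cong]: "sets mix = sets (C \<Otimes>\<^sub>M Wm)"
  using mix_in_prob_algebra by (simp add: space_prob_algebra)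

lemma prob_space_mix: "prob_space mix"
  using mix_in_prob_algebra by (simp add: space_prob_algebra)

section \<open>Integrals under the mixture and under the product of its marginals\<close>

lemma integral_mix:
  fixes f :: "nat \<times> 'w \<Rightarrow> real"
  assumes f: "f \<in> borel_measurable (C \<Otimes>\<^sub>M Wm)" and k: "\<And>x. x \<in> space (C \<Otimes>\<^sub>M Wm) \<Longrightarrow> \<bar>f x\<bar> \<le> k"
  shows "(\<integral>x. f x \<partial>mix) = (\<Sum>u<n. \<integral>w. f (u, w) \<partial>B u) / real n"
proof -
  let ?K = "\<lambda>u. B u \<bind> (\<lambda>w. return (C \<Otimes>\<^sub>M Wm) (u, w))"
  have U: "prob_space (uniform_count_measure {..<n})"
    using uniform_in_prob_algebra by (simp add: space_prob_algebra)
  have K: "?K \<in> uniform_count_measure {..<n} \<rightarrow>\<^sub>M subprob_algebra (C \<Otimes>\<^sub>M Wm)"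
    using measurable_prob_algebraD[OF kernel_measurable]
    unfolding measurable_cong_sets[OF sets_uniform_count_measure_count_space refl] .
  have K1: "AE u in uniform_count_measure {..<n}. emeasure (?K u) (space (?K u)) \<le> ennreal 1"
  proof (rule AE_I2)
    fix u assume "u \<in> space (uniform_count_measure {..<n})"
    then have "subprob_space (?K u)"
      using measurable_space[OF K] by (simp add: space_subprob_algebra)
    then show "emeasure (?K u) (space (?K u)) \<le> ennreal 1"
      using subprob_space.subprob_emeasure_le_1 by fastforce
  qed
  have "(\<integral>x. f x \<partial>mix) = (\<integral>u. (\<integral>x. f x \<partial>?K u) \<partial>uniform_count_measure {..<n})"
    unfolding uniform_mixture_def
    by (rule integral_bind[OF f k K prob_space.finite_measure[OF U] K1])
  also have "\<dots> = (\<Sum>u<n. \<integral>x. f x \<partial>?K u) / real n"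
    by (subst integral_uniform_count_measure) auto
  also have "(\<Sum>u<n. \<integral>x. f x \<partial>?K u) = (\<Sum>u<n. \<integral>w. f (u, w) \<partial>B u)"
    by (intro sum.cong refl) (simp add: bind_B_eq_distr integral_distr[OF measurable_Pair_B f])
  finally show ?thesis .
qed

lemma prob_space_joint: "prob_space joint"
  using prob_space_mix by (rule prob_space.prob_space_distr) measurable

lemma prob_space_mix_snd: "prob_space (distr mix Wm snd)"
  using prob_space_mix by (rule prob_space.prob_space_distr) measurable

lemma prob_space_mix_fst: "prob_space (distr mix C fst)"
  using prob_space_mix by (rule prob_space.prob_space_distr) measurable

lemma prob_space_indep: "prob_space indep"
  using prob_space_mix_snd prob_space_mix_fst by (rule prob_space_pair)

lemma sets_indep: "sets indep = sets (Wm \<Otimes>\<^sub>M C)"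
  by (intro sets_pair_measure_cong) auto

lemma integral_joint:
  fixes f :: "'w \<times> nat \<Rightarrow> real"
  assumes f[measurable]: "f \<in> borel_measurable (Wm \<Otimes>\<^sub>M C)" and k: "\<And>x. x \<in> space (Wm \<Otimes>\<^sub>M C) \<Longrightarrow> \<bar>f x\<bar> \<le> k"
  shows "(\<integral>x. f x \<partial>joint) = (\<Sum>u<n. \<integral>w. f (w, u) \<partial>B u) / real n"
proof -
  have "(\<integral>x. f x \<partial>joint) = (\<integral>x. f (snd x, fst x) \<partial>mix)"
    by (rule integral_distr) measurable
  also have "\<dots> = (\<Sum>u<n. \<integral>w. f (snd (u, w), fst (u, w)) \<partial>B u) / real n"
    using k by (intro integral_mix[where k = k]) (auto simp: space_pair_measure)
  finally show ?thesis by simp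
qed

text \<open>Under the product of the marginals, the weight follows the average of the
  \<open>B u\<close> and the index is uniform and independent of it; hence the inner average over
  \<open>v\<close>.\<close>

lemma integral_indep:
  fixes f :: "'w \<times> nat \<Rightarrow> real"
  assumes f[measurable]: "f \<in> borel_measurable (Wm \<Otimes>\<^sub>M C)" and k: "\<And>x. x \<in> space (Wm \<Otimes>\<^sub>M C) \<Longrightarrow> \<bar>f x\<bar> \<le> k"
  shows "(\<integral>x. f x \<partial>indep) = (\<Sum>u<n. \<integral>w. (\<Sum>v<n. f (w, v)) / real n \<partial>B u) / real n"
proof -
  interpret W: prob_space "distr mix Wm snd" by (rule prob_space_mix_snd)
  interpret U: prob_space "distr mix C fst" by (rule prob_space_mix_fst)
  interpret I: pair_prob_space "distr mix Wm snd" "distr mix C fst" ..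
  have fi: "integrable indep f"
    using k f sets_eq_imp_space_eq[OF sets_indep]
    by (intro I.P.integrable_const_bound[where B = k]) (auto simp: measurable_cong_sets[OF sets_indep refl])
  have Bi: "(\<integral>w. c \<partial>B u) = c" if "u < n" for u and c :: real
    using prob_space.prob_space[OF B_prob[OF that]] by simp
  have avg: "(\<lambda>w. (\<Sum>v<n. f (w, v)) / real n) \<in> borel_measurable Wm"
    by (intro borel_measurable_divide borel_measurable_sum measurable_const
      measurable_compose[OF measurable_Pair2' f]) auto
  have inner: "(\<integral>v. f (w, v) \<partial>distr mix C fst) = (\<Sum>v<n. f (w, v)) / real n" if w: "w \<in> space Wm" for w
  proof -
    have [measurable]: "(\<lambda>v. f (w, v)) \<in> borel_measurable C" by simp
    have "(\<integral>v. f (w, v) \<partial>distr mix C fst) = (\<integral>x. f (w, fst x) \<partial>mix)"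
      by (rule integral_distr) measurable
    also have "\<dots> = (\<Sum>u<n. \<integral>w'. f (w, fst (u, w')) \<partial>B u) / real n"
    proof (rule integral_mix[where k = k])
      show "(\<lambda>x. f (w, fst x)) \<in> borel_measurable (C \<Otimes>\<^sub>M Wm)"
        by (rule measurable_compose[OF measurable_fst]) simp
    qed (use k w in \<open>auto simp: space_pair_measure\<close>)
    finally show ?thesis by (simp add: Bi del: lebesgue_integral_const)
  qed
  have "(\<integral>x. f x \<partial>indep) = (\<integral>w. (\<integral>v. f (w, v) \<partial>distr mix C fst) \<partial>distr mix Wm snd)"
    by (rule I.integral_fst'[OF fi, symmetric])
  also have "\<dots> = (\<integral>w. (\<Sum>v<n. f (w, v)) / real n \<partial>distr mix Wm snd)"
    by (intro Bochner_Integration.integral_cong refl) (simp add: inner)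
  also have "\<dots> = (\<integral>x. (\<Sum>v<n. f (snd x, v)) / real n \<partial>mix)"
    by (rule integral_distr[OF _ avg]) measurable
  also have "\<dots> = (\<Sum>u<n. \<integral>w. (\<Sum>v<n. f (snd (u, w), v)) / real n \<partial>B u) / real n"
  proof (rule integral_mix[where k = k])
    from avg show "(\<lambda>x. (\<Sum>v<n. f (snd x, v)) / real n) \<in> borel_measurable (C \<Otimes>\<^sub>M Wm)"
      by (rule measurable_compose[OF measurable_snd])
    fix x assume "x \<in> space (C \<Otimes>\<^sub>M Wm)"
    then have "\<bar>\<Sum>v<n. f (snd x, v)\<bar> \<le> (\<Sum>v<n. k)"
      by (intro order_trans[OF sum_abs] sum_mono k) (auto simp: space_pair_measure)
    then show "\<bar>(\<Sum>v<n. f (snd x, v)) / real n\<bar> \<le> k"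
      using n_pos by (simp add: field_simps)
  qed
  finally show ?thesis by simp
qed

text \<open>The indicator at the true index is at most its sum over all indices, which is
  \<open>n\<close> times the average over an independent index. In other words, a posterior
  probability on \<open>n\<close> points is at most 1, that is \<open>n\<close> times the uniform
  weight.\<close>

lemma joint_le_indep:
  assumes X[measurable]: "X \<in> sets (Wm \<Otimes>\<^sub>M C)"
  shows "emeasure joint X \<le> ennreal (real n) * emeasure indep X"
proof -
  interpret J: prob_space joint by (rule prob_space_joint)
  interpret Q: prob_space indep by (rule prob_space_indep)
  let ?f = "indicat_real X"
  have f: "?f \<in> borel_measurable (Wm \<Otimes>\<^sub>M C)" by simp
  have Bint: "integrable (B u) (\<lambda>w. ?f (w, v))" if "u < n" "v < n" for u v
  proof (rule finite_measure.integrable_const_bound[where B = 1])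
    show "finite_measure (B u)" using B_prob[OF that(1)] by (rule prob_space.finite_measure)
    have "(\<lambda>w. ?f (w, v)) \<in> borel_measurable Wm"
      using that(2) by (intro measurable_compose[OF _ f] measurable_Pair2') auto
    then show "(\<lambda>w. ?f (w, v)) \<in> borel_measurable (B u)"
      by (simp add: measurable_cong_sets[OF B_sets[OF that(1)] refl])
  qed (auto split: split_indicator)
  have "measure joint X = (\<integral>x. ?f x \<partial>joint)" using X sets.sets_into_space[OF X] by (simp add: Int_absorb2)
  also have "\<dots> = (\<Sum>u<n. \<integral>w. ?f (w, u) \<partial>B u) / real n"
    by (rule integral_joint[OF f, where k = 1]) (auto split: split_indicator)
  also have "\<dots> \<le> (\<Sum>u<n. \<integral>w. (\<Sum>v<n. ?f (w, v)) \<partial>B u) / real n"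
  proof (intro divide_right_mono sum_mono integral_mono)
    fix u w assume "u \<in> {..<n}"
    then show "?f (w, u) \<le> (\<Sum>v<n. ?f (w, v))"
      by (intro member_le_sum) auto
  qed (auto intro!: Bochner_Integration.integrable_sum Bint)
  also have "\<dots> = real n * ((\<Sum>u<n. \<integral>w. (\<Sum>v<n. ?f (w, v)) / real n \<partial>B u) / real n)"
    using n_pos by (simp add: sum_divide_distrib[symmetric])
  also have "\<dots> = real n * (\<integral>x. ?f x \<partial>indep)"
    by (subst integral_indep[OF f, where k = 1]) (auto split: split_indicator)
  also have "\<dots> = real n * measure indep X"
    using X sets.sets_into_space[OF X] sets_eq_imp_space_eq[OF sets_indep] by (simp add: Int_absorb2)
  finally show ?thesis
    by (simp add: J.emeasure_eq_measure Q.emeasure_eq_measure ennreal_mult[symmetric])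
qed

lemma mutual_information_eq:
  "prob_space.mutual_information mix (exp 1) Wm C snd fst = KL_divergence (exp 1) indep joint"
  by (rule prob_space.mutual_information_def[OF prob_space_mix])

lemma joint_density:
  obtains h where "bounded_density indep h (real n)" "joint = density indep h"
proof -
  obtain h where "h \<in> borel_measurable indep" "\<And>x. 0 \<le> h x" "\<And>x. h x \<le> real n" "joint = density indep h"
    using bounded_density_exists[OF prob_space_indep prob_space_joint, of "real n"] joint_le_indep sets_indep by auto
  then show thesis
    using prob_space_indep
    by (intro that[of h]) (auto simp: bounded_density_def bounded_density_axioms_def)
qed

lemma decoupling_bound:
  fixes g :: "'w \<times> nat \<Rightarrow> real"
  assumes g: "g \<in> borel_measurable (Wm \<Otimes>\<^sub>M C)" and g01: "\<And>x. x \<in> space (Wm \<Otimes>\<^sub>M C) \<Longrightarrow> 0 \<le> g x \<and> g x \<le> 1"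
  shows "\<bar>(\<integral>x. g x \<partial>joint) - (\<integral>x. g x \<partial>indep)\<bar>
    \<le> sqrt (prob_space.mutual_information mix (exp 1) Wm C snd fst / 2)"
proof -
  obtain h where h: "bounded_density indep h (real n)" "joint = density indep h"
    by (rule joint_density)
  have "g \<in> borel_measurable indep" using g by (simp add: measurable_cong_sets[OF sets_indep refl])
  then show ?thesis
    using bounded_density.pinsker_bounded[OF h(1), of g] g01 prob_space_joint sets_eq_imp_space_eq[OF sets_indep]
    unfolding mutual_information_eq h(2) by auto
qed

text \<open>The bound does not depend on \<open>B\<close>; this gives integrability over the
  samples.\<close>

lemma mutual_information_bound:
  "\<bar>prob_space.mutual_information mix (exp 1) Wm C snd fst\<bar> \<le> 1 + real n * real n"
proof -
  obtain h where h: "bounded_density indep h (real n)" "joint = density indep h"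
    by (rule joint_density)
  interpret bounded_density indep h "real n" by fact
  show ?thesis
    unfolding mutual_information_eq h(2) by (rule KL_bound)
qed

end

section \<open>Deleting and inserting a sample point\<close>

text \<open>Pushing \<open>L x\<close> forward along \<open>y \<mapsto> (x, y)\<close> moves the
  parameter from the integrand into the measure, leaving a fixed function integrated against a
  measurable family.\<close>

lemma borel_measurable_integral_kernel:
  fixes f :: "'a \<Rightarrow> 'b \<Rightarrow> real"
  assumes f[measurable]: "(\<lambda>(x, y). f x y) \<in> borel_measurable (M \<Otimes>\<^sub>M N)"
    and L[measurable]: "L \<in> M \<rightarrow>\<^sub>M subprob_algebra N"
  shows "(\<lambda>x. \<integral>y. f x y \<partial>L x) \<in> borel_measurable M"
proof -
  note measurable_distr2[measurable]
  have "(\<lambda>x. integral\<^sup>L (distr (L x) (M \<Otimes>\<^sub>M N) (\<lambda>y. (x, y))) (\<lambda>(x, y). f x y)) \<in> borel_measurable M"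
    by measurable
  then show ?thesis
    by (rule measurable_cong[THEN iffD1, rotated]) (simp add: integral_distr)
qed

lemma measurable_pair_measure_countable2:
  assumes "countable A" and "\<And>y. y \<in> A \<Longrightarrow> (\<lambda>x. f (x, y)) \<in> N \<rightarrow>\<^sub>M K"
  shows "f \<in> N \<Otimes>\<^sub>M count_space A \<rightarrow>\<^sub>M K"
proof -
  have "(\<lambda>p. f (snd p, fst p)) \<in> count_space A \<Otimes>\<^sub>M N \<rightarrow>\<^sub>M K"
    using assms by (intro measurable_pair_measure_countable1) auto
  from measurable_compose[OF measurable_pair_swap' this] show ?thesis
    by (simp add: split_beta')
qed

lemma measurable_loo_delete [measurable]:
  "loo_delete n u \<in> PiM {..<n} (\<lambda>_. P) \<rightarrow>\<^sub>M PiM {..<n-1} (\<lambda>_. P)"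
  unfolding loo_delete_def[abs_def]
  by (intro measurable_restrict measurable_If measurable_component_singleton) auto

lemma bij_betw_skip:
  fixes u n :: nat
  assumes "u < n"
  shows "bij_betw (\<lambda>i. if i < u then i else Suc i) {..<n-1} ({..<n} - {u})"
  by (rule bij_betw_byWitness[where f' = "\<lambda>i. if i < u then i else i - 1"]) (use assms in auto)

text \<open>Inverse to \<open>z \<mapsto> (loo_delete n u z, z u)\<close>. The index
  \<open>i - 1\<close> occurs only for \<open>u < i\<close>, so the subtraction is never
  truncated.\<close>

definition loo_insert :: "nat \<Rightarrow> nat \<Rightarrow> (nat \<Rightarrow> 'z) \<times> 'z \<Rightarrow> (nat \<Rightarrow> 'z)" where
  "loo_insert n u = (\<lambda>(s, x). \<lambda>i\<in>{..<n}. if i < u then s i else if i = u then x else s (i - 1))"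

lemma loo_insert_at:
  assumes "u < n"
  shows "loo_insert n u (s, x) u = x"
  using assms by (simp add: loo_insert_def)

lemma loo_delete_insert:
  assumes "u < n" "s \<in> extensional {..<n-1}"
  shows "loo_delete n u (loo_insert n u (s, x)) = s"
  using assms by (auto simp: loo_delete_def loo_insert_def fun_eq_iff extensional_def)

lemma measurable_loo_insert:
  assumes "u < n"
  shows "loo_insert n u \<in> PiM {..<n-1} (\<lambda>_. P) \<Otimes>\<^sub>M P \<rightarrow>\<^sub>M PiM {..<n} (\<lambda>_. P)"
  unfolding loo_insert_def split_beta'
proof (intro measurable_restrict)
  fix i assume i: "i \<in> {..<n}"
  consider "i < u" | "i = u" | "u < i" by linarith
  then show "(\<lambda>x. if i < u then fst x i else if i = u then snd x else fst x (i - 1))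
      \<in> PiM {..<n-1} (\<lambda>_. P) \<Otimes>\<^sub>M P \<rightarrow>\<^sub>M P"
  proof cases
    case 1
    then show ?thesis using assms
      by (auto intro!: measurable_compose[OF measurable_fst] measurable_component_singleton)
  next
    case 3
    then show ?thesis using i
      by (auto intro!: measurable_compose[OF measurable_fst] measurable_component_singleton)
  qed simp
qed

text \<open>A product measure is determined by its values on boxes. The preimage of a box under
  insertion is a box with the side at \<open>u\<close> split off, and its mass is the same product
  in another order.\<close>

lemma distr_loo_insert:
  assumes P: "prob_space P" and u: "u < n"
  shows "distr (PiM {..<n-1} (\<lambda>_. P) \<Otimes>\<^sub>M P) (PiM {..<n} (\<lambda>_. P)) (loo_insert n u) = PiM {..<n} (\<lambda>_. P)"
proof -
  interpret P: prob_space P by fact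
  interpret product_sigma_finite "\<lambda>_::nat. P" ..
  define \<sigma> where "\<sigma> i = (if i < u then i else Suc i)" for i
  have \<sigma>: "bij_betw \<sigma> {..<n-1} ({..<n} - {u})"
    using bij_betw_skip[OF u] by (simp add: \<sigma>_def[abs_def])
  show ?thesis
  proof (rule PiM_eqI)
    fix A assume "\<And>i. i \<in> {..<n} \<Longrightarrow> A i \<in> sets P"
    then have A: "\<And>i. i < n \<Longrightarrow> A i \<in> sets P" by simp
    have A\<sigma>: "A (\<sigma> i) \<in> sets P" if "i < n - 1" for i
      using that by (intro A) (auto simp: \<sigma>_def)
    have vimage: "loo_insert n u -` (Pi\<^sub>E {..<n} A) \<inter> space (PiM {..<n-1} (\<lambda>_. P) \<Otimes>\<^sub>M P)
        = Pi\<^sub>E {..<n-1} (\<lambda>i. A (\<sigma> i)) \<times> A u" (is "?L = ?R")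
    proof (intro equalityI subrelI)
      fix s x assume "(s, x) \<in> ?L"
      then have sp: "s \<in> extensional {..<n-1}" "loo_insert n u (s, x) \<in> Pi\<^sub>E {..<n} A"
        by (auto simp: space_pair_measure space_PiM PiE_def)
      have x: "x \<in> A u" using PiE_mem[OF sp(2), of u] u by (simp add: loo_insert_at)
      have "s i \<in> A (\<sigma> i)" if i: "i < n - 1" for i
        using PiE_mem[OF sp(2), of "\<sigma> i"] i by (auto simp: loo_insert_def \<sigma>_def split: if_splits)
      with sp(1) x show "(s, x) \<in> ?R"
        by (auto simp: PiE_def)
    next
      fix s x assume "(s, x) \<in> ?R"
      then have s: "s \<in> Pi\<^sub>E {..<n-1} (\<lambda>i. A (\<sigma> i))" and x: "x \<in> A u" by auto
      have "s i \<in> space P" if "i < n - 1" for i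
        using PiE_mem[OF s, of i] sets.sets_into_space[OF A\<sigma>[OF that]] that by auto
      then have "(s, x) \<in> space (PiM {..<n-1} (\<lambda>_. P) \<Otimes>\<^sub>M P)"
        using s x sets.sets_into_space[OF A[OF u]] by (auto simp: space_pair_measure space_PiM PiE_iff)
      moreover have "loo_insert n u (s, x) i \<in> A i" if i: "i < n" for i
      proof -
        consider "i < u" | "i = u" | "u < i" by linarith
        then show ?thesis
        proof cases
          case 1
          then show ?thesis using PiE_mem[OF s, of i] u i by (auto simp: loo_insert_def \<sigma>_def)
        next
          case 2
          then show ?thesis using u x by (simp add: loo_insert_at)
        next
          case 3
          then obtain j where "i = Suc j" "u \<le> j" by (cases i) auto
          then show ?thesis using PiE_mem[OF s, of j] u i by (simp add: loo_insert_def \<sigma>_def)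
        qed
      qed
      ultimately show "(s, x) \<in> ?L" by (auto simp: loo_insert_def)
    qed
    have "emeasure (distr (PiM {..<n-1} (\<lambda>_. P) \<Otimes>\<^sub>M P) (PiM {..<n} (\<lambda>_. P)) (loo_insert n u)) (Pi\<^sub>E {..<n} A)
        = emeasure (PiM {..<n-1} (\<lambda>_. P) \<Otimes>\<^sub>M P) (Pi\<^sub>E {..<n-1} (\<lambda>i. A (\<sigma> i)) \<times> A u)"
      unfolding vimage[symmetric]
      using A by (intro emeasure_distr measurable_loo_insert u sets_PiM_I_finite) auto
    also have "\<dots> = emeasure (PiM {..<n-1} (\<lambda>_. P)) (Pi\<^sub>E {..<n-1} (\<lambda>i. A (\<sigma> i))) * emeasure P (A u)"
      using A\<sigma> A[OF u] by (intro P.emeasure_pair_measure_Times sets_PiM_I_finite) auto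
    also have "emeasure (PiM {..<n-1} (\<lambda>_. P)) (Pi\<^sub>E {..<n-1} (\<lambda>i. A (\<sigma> i))) = (\<Prod>i<n-1. emeasure P (A (\<sigma> i)))"
      using A\<sigma> by (intro emeasure_PiM) auto
    also have "\<dots> = (\<Prod>i\<in>{..<n} - {u}. emeasure P (A i))"
      by (rule prod.reindex_bij_betw[OF \<sigma>])
    also have "\<dots> * emeasure P (A u) = (\<Prod>i\<in>{..<n}. emeasure P (A i))"
      using u by (subst prod.remove[of "{..<n}" u]) (auto simp: mult.commute)
    finally show "emeasure (distr (PiM {..<n-1} (\<lambda>_. P) \<Otimes>\<^sub>M P) (PiM {..<n} (\<lambda>_. P)) (loo_insert n u)) (Pi\<^sub>E {..<n} A)
      = (\<Prod>i\<in>{..<n}. emeasure P (A i))" .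
  qed auto
qed

text \<open>The form of exchangeability used below: under the full product law, the remaining sample
  and the deleted point have the same joint law for every \<open>u\<close>, namely that of a
  training sample and an independent point.\<close>

lemma integral_loo_split:
  fixes E :: "(nat \<Rightarrow> 'z) \<Rightarrow> 'z \<Rightarrow> real"
  assumes P: "prob_space P" and u: "u < n"
    and E: "(\<lambda>(s, x). E s x) \<in> borel_measurable (PiM {..<n-1} (\<lambda>_. P) \<Otimes>\<^sub>M P)"
  shows "(\<integral>z. E (loo_delete n u z) (z u) \<partial>PiM {..<n} (\<lambda>_. P))
    = (\<integral>p. E (fst p) (snd p) \<partial>(PiM {..<n-1} (\<lambda>_. P) \<Otimes>\<^sub>M P))"
proof -
  have meas: "(\<lambda>z. E (loo_delete n u z) (z u)) \<in> borel_measurable (PiM {..<n} (\<lambda>_. P))"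
    using u measurable_compose[OF measurable_Pair[OF measurable_loo_delete measurable_component_singleton] E]
    by auto
  have "(\<integral>z. E (loo_delete n u z) (z u) \<partial>PiM {..<n} (\<lambda>_. P))
    = (\<integral>p. E (loo_delete n u (loo_insert n u p)) (loo_insert n u p u) \<partial>(PiM {..<n-1} (\<lambda>_. P) \<Otimes>\<^sub>M P))"
    by (subst distr_loo_insert[OF P u, symmetric]) (rule integral_distr[OF measurable_loo_insert[OF u] meas])
  also have "\<dots> = (\<integral>p. E (fst p) (snd p) \<partial>(PiM {..<n-1} (\<lambda>_. P) \<Otimes>\<^sub>M P))"
    using u by (intro Bochner_Integration.integral_cong)
      (auto simp: space_pair_measure space_PiM PiE_def loo_delete_insert loo_insert_at)
  finally show ?thesis .
qed

section \<open>The leave-one-out bound\<close>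

text \<open>The full sum on the right is the same for all \<open>u\<close>; this lets the
  leave-one-out averages be compared with an average over an independent index.\<close>

lemma emp_loss_loo_delete:
  assumes "u < n"
  shows "emp_loss (n - 1) l w (loo_delete n u z) = (1 / real (n - 1)) * ((\<Sum>i<n. l w (z i)) - l w (z u))"
proof -
  have "(\<Sum>i<n-1. l w (loo_delete n u z i)) = (\<Sum>i<n-1. l w (z (if i < u then i else Suc i)))"
    by (intro sum.cong) (auto simp: loo_delete_def)
  also have "\<dots> = (\<Sum>i\<in>{..<n} - {u}. l w (z i))"
    by (rule sum.reindex_bij_betw[OF bij_betw_skip[OF assms]])
  also have "\<dots> = (\<Sum>i<n. l w (z i)) - l w (z u)"
    using assms by (subst sum.remove[of "{..<n}" u]) auto
  finally show ?thesis by (simp add: emp_loss_def)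
qed

text \<open>The weight space is abstract; of Euclidean space only countable generation is
  retained.\<close>

locale loo_setting =
  fixes n :: nat and P :: "'z measure" and Wm :: "'w measure"
    and A :: "(nat \<Rightarrow> 'z) \<Rightarrow> 'w measure" and l :: "'w \<Rightarrow> 'z \<Rightarrow> real"
  assumes n2: "2 \<le> n"
    and P_prob: "prob_space P"
    and Wm_cg: "countably_generated Wm"
    and A_kernel: "A \<in> PiM {..<n-1} (\<lambda>_. P) \<rightarrow>\<^sub>M prob_algebra Wm"
    and l_meas: "(\<lambda>(w, z). l w z) \<in> borel_measurable (Wm \<Otimes>\<^sub>M P)"
    and l_range: "w \<in> space Wm \<Longrightarrow> z \<in> space P \<Longrightarrow> 0 \<le> l w z \<and> l w z \<le> 1"
begin

abbreviation "Train \<equiv> PiM {..<n-1} (\<lambda>_. P)"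
abbreviation "Full \<equiv> PiM {..<n} (\<lambda>_. P)"
abbreviation "Idx \<equiv> count_space {..<n}"

lemma prob_space_PiM_P: "prob_space (PiM I (\<lambda>_. P))"
  using P_prob by (rule prob_space_PiM)

lemma A_space:
  assumes "s \<in> space Train"
  shows "prob_space (A s)" "sets (A s) = sets Wm" "space (A s) = space Wm"
  using measurable_space[OF A_kernel assms] by (auto simp: space_prob_algebra dest: sets_eq_imp_space_eq)

lemma mixture_kernel:
  assumes "z \<in> space Full"
  shows "uniform_mixture_kernel n Wm (\<lambda>u. A (loo_delete n u z))"
  using n2 A_space[OF measurable_space[OF measurable_loo_delete assms]]
  by (simp add: uniform_mixture_kernel_def)

section \<open>Measurability and integrability of the leave-one-out information\<close>

lemma measurable_loo_joint: "loo_joint n Wm A \<in> Full \<rightarrow>\<^sub>M prob_algebra (Idx \<Otimes>\<^sub>M Wm)"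
  unfolding loo_joint_def[abs_def]
proof (rule measurable_bind_prob_space2)
  have "uniform_count_measure {..<n} \<in> space (prob_algebra Idx)"
    using n2 by (intro uniform_count_measure_in_prob_algebra) (auto simp: lessThan_empty_iff)
  then show "(\<lambda>z. uniform_count_measure {..<n}) \<in> Full \<rightarrow>\<^sub>M prob_algebra Idx"
    by simp
  \<comment> \<open>The index set is countable and discrete, so measurability in
    \<open>(z, u)\<close> reduces to each fixed \<open>u\<close>.\<close>
  have "(\<lambda>z. A (loo_delete n u z) \<bind> (\<lambda>w. return (Idx \<Otimes>\<^sub>M Wm) (u, w)))
      \<in> Full \<rightarrow>\<^sub>M prob_algebra (Idx \<Otimes>\<^sub>M Wm)" if "u < n" for u
    using that by (intro measurable_bind_prob_space[OF measurable_compose[OF measurable_loo_delete A_kernel]]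
      measurable_compose[OF measurable_Pair1' measurable_return_prob_space]) simp
  then show "(\<lambda>(z, u). A (loo_delete n u z) \<bind> (\<lambda>w. return (Idx \<Otimes>\<^sub>M Wm) (u, w)))
      \<in> Full \<Otimes>\<^sub>M Idx \<rightarrow>\<^sub>M prob_algebra (Idx \<Otimes>\<^sub>M Wm)"
    by (intro measurable_pair_measure_countable2) auto
qed

text \<open>The joint law and the product of its marginals are both kernels in \<open>z\<close>,
  with the domination constant \<open>n\<close> for every \<open>z\<close>, so the countable
  supremum applies.\<close>

lemma borel_measurable_loo_CMI: "loo_CMI n Wm A \<in> borel_measurable Full"
proof -
  note joint = measurable_loo_joint
  let ?Q = "\<lambda>z. distr (loo_joint n Wm A z) Wm snd \<Otimes>\<^sub>M distr (loo_joint n Wm A z) Idx fst"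
  let ?J = "\<lambda>z. distr (loo_joint n Wm A z) (Wm \<Otimes>\<^sub>M Idx) (\<lambda>x. (snd x, fst x))"
  have "(\<lambda>z. KL_divergence (exp 1) (?Q z) (?J z)) \<in> borel_measurable Full"
  proof (rule borel_measurable_KL_divergence)
    show "countably_generated (Wm \<Otimes>\<^sub>M Idx)"
      by (intro countably_generated_pair Wm_cg countably_generated_count_space) simp
    show "?Q \<in> Full \<rightarrow>\<^sub>M prob_algebra (Wm \<Otimes>\<^sub>M Idx)"
      by (intro measurable_pair_prob measurable_compose[OF joint measurable_distr_prob_space]) auto
    show "?J \<in> Full \<rightarrow>\<^sub>M prob_algebra (Wm \<Otimes>\<^sub>M Idx)"
      by (intro measurable_compose[OF joint measurable_distr_prob_space]) auto
    show "emeasure (?J z) X \<le> ennreal (real n) * emeasure (?Q z) X"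
      if "z \<in> space Full" "X \<in> sets (Wm \<Otimes>\<^sub>M Idx)" for z X
      using uniform_mixture_kernel.joint_le_indep[OF mixture_kernel[OF that(1)] that(2)]
      by (simp add: loo_joint_eq_uniform_mixture)
  qed
  moreover have "loo_CMI n Wm A z = KL_divergence (exp 1) (?Q z) (?J z)" if "z \<in> space Full" for z
    using uniform_mixture_kernel.mutual_information_eq[OF mixture_kernel[OF that]]
    by (simp add: loo_CMI_def loo_joint_eq_uniform_mixture)
  ultimately show ?thesis by (simp cong: measurable_cong)
qed

lemma integrable_sqrt_loo_CMI: "integrable Full (\<lambda>z. sqrt (loo_CMI n Wm A z))"
proof -
  interpret prob_space Full by (rule prob_space_PiM_P)
  note borel_measurable_loo_CMI[measurable]
  show ?thesis
  proof (rule integrable_const_bound[where B = "sqrt (1 + real n * real n)"])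
    show "AE z in Full. norm (sqrt (loo_CMI n Wm A z)) \<le> sqrt (1 + real n * real n)"
    proof (rule AE_I2)
      fix z assume "z \<in> space Full"
      \<comment> \<open>The real square root is odd, so \<open>|sqrt x| = sqrt |x|\<close> and a
        bound on the absolute value suffices.\<close>
      then show "norm (sqrt (loo_CMI n Wm A z)) \<le> sqrt (1 + real n * real n)"
        using uniform_mixture_kernel.mutual_information_bound[OF mixture_kernel]
        by (simp add: loo_CMI_def loo_joint_eq_uniform_mixture real_sqrt_abs2 flip: real_sqrt_abs')
    qed
  qed measurable
qed

section \<open>Held-out loss minus training loss, and its averages\<close>

definition gap :: "(nat \<Rightarrow> 'z) \<Rightarrow> 'z \<Rightarrow> 'w \<Rightarrow> real" where
  "gap s x w = l w x - emp_loss (n - 1) l w s"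

lemma emp_loss_range:
  assumes "s \<in> space Train" "w \<in> space Wm"
  shows "0 \<le> emp_loss (n - 1) l w s \<and> emp_loss (n - 1) l w s \<le> 1"
proof -
  have "s i \<in> space P" if "i < n - 1" for i
    using assms(1) that by (auto simp: space_PiM)
  then have l01: "0 \<le> l w (s i) \<and> l w (s i) \<le> 1" if "i < n - 1" for i
    using l_range[OF assms(2)] that by blast
  then have "0 \<le> (\<Sum>i<n-1. l w (s i))" by (intro sum_nonneg) auto
  moreover have "(\<Sum>i<n-1. l w (s i)) \<le> (\<Sum>i<n-1. 1)" using l01 by (intro sum_mono) auto
  ultimately show ?thesis using n2 by (auto simp: emp_loss_def field_simps)
qed

lemma gap_bound:
  assumes "s \<in> space Train" "x \<in> space P" "w \<in> space Wm"
  shows "\<bar>gap s x w\<bar> \<le> 1"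
  using emp_loss_range[OF assms(1,3)] l_range[OF assms(3,2)] by (auto simp: gap_def abs_le_iff)

lemma measurable_gap: "(\<lambda>((s, x), w). gap s x w) \<in> borel_measurable ((Train \<Otimes>\<^sub>M P) \<Otimes>\<^sub>M Wm)"
proof -
  have l': "(\<lambda>p. l (snd p) (f p)) \<in> borel_measurable ((Train \<Otimes>\<^sub>M P) \<Otimes>\<^sub>M Wm)"
    if "f \<in> (Train \<Otimes>\<^sub>M P) \<Otimes>\<^sub>M Wm \<rightarrow>\<^sub>M P" for f
    using measurable_compose[OF measurable_Pair[OF measurable_snd that] l_meas] by simp
  have "(\<lambda>p. l (snd p) (snd (fst p)) - (1 / real (n - 1)) * (\<Sum>i<n-1. l (snd p) (fst (fst p) i)))
      \<in> borel_measurable ((Train \<Otimes>\<^sub>M P) \<Otimes>\<^sub>M Wm)"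
    by (intro borel_measurable_diff borel_measurable_times measurable_const borel_measurable_sum l')
       (auto intro!: measurable_compose[OF measurable_fst] measurable_component_singleton)
  then show ?thesis by (simp add: gap_def emp_loss_def split_beta')
qed

definition expected_gap :: "(nat \<Rightarrow> 'z) \<Rightarrow> 'z \<Rightarrow> real" where
  "expected_gap s x = (\<integral>w. gap s x w \<partial>A s)"

lemma measurable_expected_gap: "(\<lambda>(s, x). expected_gap s x) \<in> borel_measurable (Train \<Otimes>\<^sub>M P)"
proof -
  have "(\<lambda>p. \<integral>w. gap (fst p) (snd p) w \<partial>A (fst p)) \<in> borel_measurable (Train \<Otimes>\<^sub>M P)"
  proof (rule borel_measurable_integral_kernel)
    show "(\<lambda>(p, w). gap (fst p) (snd p) w) \<in> borel_measurable ((Train \<Otimes>\<^sub>M P) \<Otimes>\<^sub>M Wm)"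
      using measurable_gap by (simp add: split_beta')
    show "(\<lambda>p. A (fst p)) \<in> Train \<Otimes>\<^sub>M P \<rightarrow>\<^sub>M subprob_algebra Wm"
      by (intro measurable_compose[OF measurable_fst] measurable_prob_algebraD A_kernel)
  qed
  then show ?thesis by (simp add: expected_gap_def split_beta')
qed

lemma expected_gap_bound:
  assumes "s \<in> space Train" "x \<in> space P"
  shows "\<bar>expected_gap s x\<bar> \<le> 1"
proof -
  interpret prob_space "A s" by (rule A_space[OF assms(1)])
  have "\<bar>expected_gap s x\<bar> \<le> (\<integral>w. \<bar>gap s x w\<bar> \<partial>A s)"
    unfolding expected_gap_def by (rule integral_abs_bound)
  also have "\<dots> \<le> 1"
  proof (rule integral_le_const)
    have "(\<lambda>w. gap s x w) \<in> borel_measurable Wm"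
      using measurable_compose[OF measurable_Pair1'[of "(s, x)"] measurable_gap] assms
      by (simp add: space_pair_measure)
    then show "integrable (A s) (\<lambda>w. \<bar>gap s x w\<bar>)"
      using assms gap_bound A_space[OF assms(1)]
      by (intro integrable_const_bound[where B = 1])
         (auto simp: measurable_cong_sets[OF A_space(2)[OF assms(1)] refl])
    show "AE w in A s. \<bar>gap s x w\<bar> \<le> 1"
      using assms gap_bound A_space[OF assms(1)] by (intro AE_I2) auto
  qed
  finally show ?thesis .
qed

lemma integrable_expected_gap: "integrable (Train \<Otimes>\<^sub>M P) (\<lambda>(s, x). expected_gap s x)"
proof -
  interpret prob_space "Train \<Otimes>\<^sub>M P" by (intro prob_space_pair prob_space_PiM_P P_prob)
  show ?thesis
    using measurable_expected_gap expected_gap_bound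
    by (intro integrable_const_bound[where B = 1] AE_I2) (auto simp: space_pair_measure)
qed

text \<open>By Fubini the held-out point can be averaged first, which turns \<open>l w x\<close>
  into the true loss; the empirical loss is constant in \<open>x\<close>.\<close>

lemma integral_expected_gap:
  assumes s: "s \<in> space Train"
  shows "(\<integral>x. expected_gap s x \<partial>P) = (\<integral>w. true_loss P l w - emp_loss (n - 1) l w s \<partial>A s)"
proof -
  interpret A: prob_space "A s" by (rule A_space[OF s])
  interpret P: prob_space P by (rule P_prob)
  interpret AP: pair_prob_space "A s" P ..
  have sets: "sets (A s \<Otimes>\<^sub>M P) = sets (Wm \<Otimes>\<^sub>M P)"
    by (intro sets_pair_measure_cong A_space[OF s] refl)
  have "(\<lambda>p. gap s (snd p) (fst p)) \<in> borel_measurable (Wm \<Otimes>\<^sub>M P)"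
    using measurable_compose[OF measurable_Pair[OF measurable_Pair[OF measurable_const[OF s] measurable_snd] measurable_fst]
      measurable_gap] by simp
  then have int: "integrable (A s \<Otimes>\<^sub>M P) (\<lambda>(w, x). gap s x w)"
    using gap_bound[OF s] A_space[OF s]
    by (intro AP.P.integrable_const_bound[where B = 1] AE_I2)
       (auto simp: space_pair_measure split_beta' measurable_cong_sets[OF sets refl])
  have "(\<integral>x. expected_gap s x \<partial>P) = (\<integral>w. (\<integral>x. gap s x w \<partial>P) \<partial>A s)"
    unfolding expected_gap_def by (rule AP.Fubini_integral[OF int])
  also have "\<dots> = (\<integral>w. true_loss P l w - emp_loss (n - 1) l w s \<partial>A s)"
  proof (rule Bochner_Integration.integral_cong[OF refl])
    fix w assume "w \<in> space (A s)"
    then have w: "w \<in> space Wm" using A_space[OF s] by simp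
    have "integrable P (l w)"
      using l_range[OF w] measurable_compose[OF measurable_Pair1'[OF w] l_meas]
      by (intro P.integrable_const_bound[where B = 1] AE_I2) (auto simp: abs_le_iff)
    then show "(\<integral>x. gap s x w \<partial>P) = true_loss P l w - emp_loss (n - 1) l w s"
      by (simp add: gap_def true_loss_def P.prob_space)
  qed
  finally show ?thesis .
qed

text \<open>The deleted point is independent of the sample on which the algorithm is trained, so it
  serves as the fresh point defining the true loss.\<close>

lemma gen_gap_eq_loo:
  assumes u: "u < n"
  shows "gen_gap n P A l = \<bar>\<integral>z. expected_gap (loo_delete n u z) (z u) \<partial>Full\<bar>"
proof -
  interpret T: prob_space Train by (rule prob_space_PiM_P)
  interpret P: prob_space P by (rule P_prob)
  interpret TP: pair_prob_space Train P ..
  have "(\<integral>z. expected_gap (loo_delete n u z) (z u) \<partial>Full) = (\<integral>p. expected_gap (fst p) (snd p) \<partial>(Train \<Otimes>\<^sub>M P))"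
    by (rule integral_loo_split[OF P_prob u measurable_expected_gap])
  also have "\<dots> = (\<integral>s. (\<integral>x. expected_gap s x \<partial>P) \<partial>Train)"
    using TP.integral_fst'[OF integrable_expected_gap] by (simp add: split_beta')
  also have "\<dots> = (\<integral>s. (\<integral>w. true_loss P l w - emp_loss (n - 1) l w s \<partial>A s) \<partial>Train)"
    by (intro Bochner_Integration.integral_cong refl integral_expected_gap)
  finally show ?thesis by (simp add: gen_gap_def)
qed

text \<open>For a fixed sample the average gap is a multiple of the difference between the joint and
  the decoupled mean of one function \<open>g\<close>, to which \<open>decoupling_bound\<close>
  applies.\<close>

lemma loo_average_bound:
  assumes z: "z \<in> space Full"
  shows "\<bar>(\<Sum>u<n. expected_gap (loo_delete n u z) (z u)) / real n\<bar>
    \<le> (real n / (real n - 1)) / sqrt 2 * sqrt (loo_CMI n Wm A z)"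
proof -
  interpret uniform_mixture_kernel n Wm "\<lambda>u. A (loo_delete n u z)"
    by (rule mixture_kernel[OF z])
  define g where "g p = l (fst p) (z (snd p))" for p
  have zP: "z u \<in> space P" if "u < n" for u using z that by (auto simp: space_PiM)
  have lw: "(\<lambda>w. l w (z u)) \<in> borel_measurable Wm" if "u < n" for u
    using measurable_compose[OF measurable_Pair2'[OF zP[OF that]] l_meas] by simp
  have g_meas: "g \<in> borel_measurable (Wm \<Otimes>\<^sub>M Idx)"
    using lw by (intro measurable_pair_measure_countable2) (auto simp: g_def)
  have g01: "0 \<le> g p \<and> g p \<le> 1" if "p \<in> space (Wm \<Otimes>\<^sub>M Idx)" for p
    using that l_range zP by (auto simp: g_def space_pair_measure)
  have int: "integrable (A (loo_delete n u z)) (\<lambda>w. l w (z v))" if "u < n" "v < n" for u v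
  proof (rule finite_measure.integrable_const_bound[where B = 1])
    note s = measurable_space[OF measurable_loo_delete z, of u]
    show "finite_measure (A (loo_delete n u z))"
      using A_space(1)[OF s] by (rule prob_space.finite_measure)
    show "(\<lambda>w. l w (z v)) \<in> borel_measurable (A (loo_delete n u z))"
      using lw[OF that(2)] by (simp add: measurable_cong_sets[OF A_space(2)[OF s] refl])
    show "AE w in A (loo_delete n u z). norm (l w (z v)) \<le> 1"
      using l_range zP[OF that(2)] A_space(3)[OF s] by (intro AE_I2) (auto simp: abs_le_iff)
  qed
  define c where "c = real n / (real n - 1)"
  have c: "0 \<le> c" using n2 by (simp add: c_def)
  have "expected_gap (loo_delete n u z) (z u)
      = c * ((\<integral>w. g (w, u) \<partial>A (loo_delete n u z)) - (\<integral>w. (\<Sum>v<n. g (w, v)) / real n \<partial>A (loo_delete n u z)))"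
    if u: "u < n" for u
  proof -
    \<comment> \<open>With \<open>S\<close> the full sum and \<open>a\<close> the loss at
      \<open>z u\<close>, \<open>a - (S - a) / (n - 1) = n / (n - 1) * (a - S / n)\<close>; this is
      the source of the factor \<open>c\<close>.\<close>
    have "gap (loo_delete n u z) (z u) = (\<lambda>w. c * (g (w, u) - (\<Sum>v<n. g (w, v)) / real n))"
      using n2 unfolding gap_def emp_loss_loo_delete[OF u] by (simp add: fun_eq_iff g_def c_def field_simps)
    moreover have "integrable (A (loo_delete n u z)) (\<lambda>w. g (w, v))" if "v < n" for v
      using int[OF u that] by (simp add: g_def)
    then have "integrable (A (loo_delete n u z)) (\<lambda>w. g (w, u))"
      "integrable (A (loo_delete n u z)) (\<lambda>w. (\<Sum>v<n. g (w, v)) / real n)"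
      using u by (auto intro!: Bochner_Integration.integrable_sum integrable_divide)
    ultimately show ?thesis
      unfolding expected_gap_def
      by (simp only: integral_mult_right_zero Bochner_Integration.integral_diff)
  qed
  then have "(\<Sum>u<n. expected_gap (loo_delete n u z) (z u)) / real n
      = c * ((\<Sum>u<n. \<integral>w. g (w, u) \<partial>A (loo_delete n u z)) / real n
        - (\<Sum>u<n. \<integral>w. (\<Sum>v<n. g (w, v)) / real n \<partial>A (loo_delete n u z)) / real n)"
    by (simp add: sum_subtractf sum_distrib_left[symmetric] diff_divide_distrib[symmetric])
  also have "\<dots> = c * ((\<integral>x. g x \<partial>joint) - (\<integral>x. g x \<partial>indep))"
    using g01 by (subst integral_joint[OF g_meas, where k = 1], force)
      (subst integral_indep[OF g_meas, where k = 1], force, rule refl)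
  finally have "\<bar>(\<Sum>u<n. expected_gap (loo_delete n u z) (z u)) / real n\<bar>
      = c * \<bar>(\<integral>x. g x \<partial>joint) - (\<integral>x. g x \<partial>indep)\<bar>"
    using c by (simp add: abs_mult)
  also have "\<dots> \<le> c * sqrt (loo_CMI n Wm A z / 2)"
    using decoupling_bound[OF g_meas g01] c
    by (intro mult_left_mono) (simp_all add: loo_CMI_def loo_joint_eq_uniform_mixture)
  finally show ?thesis by (simp add: c_def real_sqrt_divide)
qed

theorem gen_gap_le:
  "gen_gap n P A l
    \<le> (real n / (real n - 1)) / sqrt 2 * (\<integral>z. sqrt (loo_CMI n Wm A z) \<partial>Full)"
proof -
  interpret Full: prob_space Full by (rule prob_space_PiM_P)
  let ?e = "\<lambda>u z. expected_gap (loo_delete n u z) (z u)"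
  have int: "integrable Full (?e u)" if u: "u < n" for u
  proof (rule Full.integrable_const_bound[where B = 1])
    show "?e u \<in> borel_measurable Full"
      using u measurable_compose[OF measurable_Pair[OF measurable_loo_delete measurable_component_singleton]
        measurable_expected_gap] by auto
    show "AE z in Full. norm (?e u z) \<le> 1"
    proof (rule AE_I2)
      fix z assume z: "z \<in> space Full"
      then have "z u \<in> space P" using u by (auto simp: space_PiM)
      with measurable_space[OF measurable_loo_delete z] show "norm (?e u z) \<le> 1"
        by (simp add: expected_gap_bound)
    qed
  qed
  \<comment> \<open>Every index gives the same integral, so the generalization gap is also the
    integral of the average over all indices.\<close>
  have same: "(\<integral>z. ?e u z \<partial>Full) = (\<integral>z. ?e 0 z \<partial>Full)" if "u < n" for u
    using n2 that integral_loo_split[OF P_prob _ measurable_expected_gap, of u]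
      integral_loo_split[OF P_prob _ measurable_expected_gap, of 0] by simp
  have "(\<integral>z. (\<Sum>u<n. ?e u z) / real n \<partial>Full) = (\<Sum>u<n. \<integral>z. ?e u z \<partial>Full) / real n"
    using int by simp
  also have "\<dots> = (\<integral>z. ?e 0 z \<partial>Full)"
    using n2 by (subst sum.cong[OF refl same]) auto
  finally have "gen_gap n P A l = \<bar>\<integral>z. (\<Sum>u<n. ?e u z) / real n \<partial>Full\<bar>"
    using n2 by (simp add: gen_gap_eq_loo[of 0])
  \<comment> \<open>The absolute value moves inside the integral over \<open>z\<close> but stays
    outside the average over \<open>u\<close>, as the bound for a fixed sample requires.\<close>
  also have "\<dots> \<le> (\<integral>z. \<bar>(\<Sum>u<n. ?e u z) / real n\<bar> \<partial>Full)"
    by (rule integral_abs_bound)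
  also have "\<dots> \<le> (\<integral>z. (real n / (real n - 1)) / sqrt 2 * sqrt (loo_CMI n Wm A z) \<partial>Full)"
  proof (rule integral_mono[OF _ _ loo_average_bound])
    show "integrable Full (\<lambda>z. \<bar>(\<Sum>u<n. ?e u z) / real n\<bar>)"
      using int by (intro integrable_abs integrable_divide Bochner_Integration.integrable_sum) auto
    show "integrable Full (\<lambda>z. (real n / (real n - 1)) / sqrt 2 * sqrt (loo_CMI n Wm A z))"
      using integrable_sqrt_loo_CMI by (rule integrable_mult_right)
  qed
  also have "\<dots> = (real n / (real n - 1)) / sqrt 2 * (\<integral>z. sqrt (loo_CMI n Wm A z) \<partial>Full)"
    by (rule integral_mult_right_zero)
  finally show ?thesis .
qed

end

theorem theorem1:
  fixes n :: nat
    and P :: "('x \<times> 'y) measure"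
    and Wset :: "(real ^ 'k) set"
    and A :: "(nat \<Rightarrow> 'x \<times> 'y) \<Rightarrow> (real ^ 'k) measure"
    and l :: "real ^ 'k \<Rightarrow> 'x \<times> 'y \<Rightarrow> real"
  assumes n2: "n \<ge> 2"
    and P_prob: "prob_space P"
    and A_kernel: "A \<in> measurable (PiM {..<n-1} (\<lambda>_. P)) (prob_algebra (restrict_space borel Wset))"
    and l_meas: "(\<lambda>(w, z). l w z) \<in> borel_measurable (restrict_space borel Wset \<Otimes>\<^sub>M P)"
    and l_range: "\<And>w z. w \<in> Wset \<Longrightarrow> z \<in> space P \<Longrightarrow> 0 \<le> l w z \<and> l w z \<le> 1"
  shows "gen_gap n P A l
           \<le> (real n / (real n - 1)) / sqrt 2 *
             (\<integral>z. sqrt (loo_CMI n (restrict_space borel Wset) A z) \<partial>(PiM {..<n} (\<lambda>_. P)))"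
proof -
  interpret loo_setting n P "restrict_space borel Wset" A l
  proof (rule loo_setting.intro)
    \<comment> \<open>Countable generation passes to the trace of the Borel sets on an arbitrary
      subset of the Euclidean space.\<close>
    show "countably_generated (restrict_space borel Wset)"
      by (intro countably_generated_restrict_space countably_generated_borel)
    show "0 \<le> l w z \<and> l w z \<le> 1" if "w \<in> space (restrict_space borel Wset)" "z \<in> space P" for w z
      using l_range that by (simp add: space_restrict_space)
  qed fact+
  show ?thesis by (rule gen_gap_le)
qed

end
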